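(* Let $(x_1,x_2,x_3,x_4)$ be coordinates of $\mathbb R^4$. Any essential infinitesimal generalized solitonic deformation $\gamma$ on the unit sphere $S^3=\{|x|=1\}$ (with its Bismut-flat structure $(g,H)$) is of the form $$\gamma=4ug+\nabla^2u-\tfrac12d^*(uH),$$ where $u$ lies in the span of the functions $$\{x_1x_2,\ x_1x_3,\ x_1x_4,\ x_2x_3,\ x_2x_4,\ x_3x_4,\ x_1^2-x_2^2,\ x_1^2-x_3^2,\ x_1^2-x_4^2\}$$ restricted to the unit sphere. The dimension of the space of essential infinitesimal generalized solitonic deformations on $S^3$ is $9$.
   Context: $g$ is the standard metric on the unit sphere $S^3$ (so $\mathrm{Rc}=2g$) and $H=2\,dV_g$; this structure is Bismut-flat, i.e. the curvature of $\nabla^+$ vanishes, where $\langle\nabla^\pm_XY,Z\rangle=\langle\nabla_XY,Z\rangle\pm\frac12H(X,Y,Z)$. $(d^*(uH))_{ij}=-\nabla_l(uH)_{lij}$ in an orthonormal frame. Mixed Bismut connection on 2-tensors: $(\overline\nabla_X\gamma)(Y,Z)=X(\gamma(Y,Z))-\gamma(\nabla^-_XY,Z)-\gamma(Y,\nabla^+_XZ)$; $\overline\triangle=-\overline\nabla^*\overline\nabla$ ($L^2$ adjoint). With $R^+$ the curvature of $\nabla^+$ (zero here), $\mathring R^+(\gamma)_{jk}=R^+_{ijkl}\gamma_{il}$ and $\mathcal B(\gamma)=-\frac12\overline\triangle\gamma-\mathring R^+(\gamma)$. An essential infinitesimal generalized solitonic deformation is a 2-tensor $\gamma$ with $\mathcal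 B(\gamma)=0$ and $\overline\nabla_m\gamma_{ml}=0$, $\overline\nabla_m\gamma_{lm}=0$ (orthonormal frame, sum over $m$; the minimizer $f$ of the associated energy is constant here, so no $f$-terms occur). *)

theory Defs
  imports "HOL-Analysis.Analysis" "HOL-Library.Function_Algebras"
begin

text \<open>Spaces of functions and of tensor fields are real vector spaces under the pointwise operations.\<close>

instantiation "fun" :: (type, real_vector) real_vector
begin

definition scaleR_fun_def: "c *\<^sub>R f = (\<lambda>x. c *\<^sub>R f x)"

instance
  by standard (auto simp: scaleR_fun_def fun_eq_iff scaleR_add_right scaleR_add_left)

end

section \<open>Smooth functions and vector fields on the unit three-sphere\<close>

abbreviation S3 :: "(real^4) set" where
  "S3 \<equiv> sphere 0 1"

definition tangent :: "real^4 \<Rightarrow> (real^4) set" where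
  "tangent p = {v. v \<bullet> p = 0}"

definition tproj :: "real^4 \<Rightarrow> real^4 \<Rightarrow> real^4" where
  "tproj p v = v - (v \<bullet> p) *\<^sub>R p"

text \<open>\<open>Ck k U f\<close> is meant for open \<open>U\<close>: the map \<open>f\<close> is \<open>k\<close> times continuously
  differentiable on \<open>U\<close>.\<close>

primrec Ck :: "nat \<Rightarrow> (real^4) set \<Rightarrow> (real^4 \<Rightarrow> 'b::real_normed_vector) \<Rightarrow> bool" where
  "Ck 0 U f \<longleftrightarrow> continuous_on U f"
| "Ck (Suc k) U f \<longleftrightarrow>
     f differentiable_on U \<and> (\<forall>v. Ck k U (\<lambda>x. frechet_derivative f (at x) v))"

definition smooth_S3 :: "(real^4 \<Rightarrow> 'b::real_normed_vector) \<Rightarrow> bool" where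
  "smooth_S3 f \<longleftrightarrow> (\<exists>U F. open U \<and> S3 \<subseteq> U \<and> (\<forall>k. Ck k U F) \<and> (\<forall>p\<in>S3. F p = f p))"

text \<open>Functions and fields on \<open>S3\<close> are total functions on the ambient space of which only the values
  on \<open>S3\<close> matter.\<close>

definition smooth_vfield :: "(real^4 \<Rightarrow> real^4) \<Rightarrow> bool" where
  "smooth_vfield X \<longleftrightarrow> smooth_S3 X \<and> (\<forall>p\<in>S3. X p \<in> tangent p)"

text \<open>Derivative of \<open>f\<close> at \<open>p\<close> in direction \<open>v\<close>, for \<open>v\<close> tangent to the sphere. The derivative
  within \<open>S3\<close> is not unique as a linear map on the ambient space, but its restriction to the tangent
  space is (lemma \<open>D_S_eq\<close> below), and it depends on \<open>f\<close> only through its values on \<open>S3\<close>.\<close>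

definition D_S :: "(real^4 \<Rightarrow> 'b::real_normed_vector) \<Rightarrow> real^4 \<Rightarrow> real^4 \<Rightarrow> 'b" where
  "D_S f p v = frechet_derivative f (at p within S3) v"

lemma D_S_eq:
  fixes f :: "real^4 \<Rightarrow> 'b::real_normed_vector"
  assumes f: "(f has_derivative f') (at p within S3)" and p: "p \<in> S3" and v: "v \<in> tangent p"
  shows "D_S f p v = f' v"
proof (cases "v = 0")
  case True
  have "f differentiable (at p within S3)" using f by (auto simp: differentiable_def)
  then have "(f has_derivative frechet_derivative f (at p within S3)) (at p within S3)"
    by (simp add: frechet_derivative_works)
  then have "linear (frechet_derivative f (at p within S3))" "linear f'"
    using f has_derivative_linear by blast+
  then show ?thesis using True by (simp add: D_S_def linear_0)
next
  case False
  define w where "w = v /\<^sub>R norm v"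
  have nw: "w \<bullet> w = 1" using False by (simp add: w_def dot_square_norm power2_eq_square)
  have wp: "w \<bullet> p = 0" "p \<bullet> w = 0" using v by (auto simp: w_def tangent_def inner_commute)
  have pp: "p \<bullet> p = 1" using p by (simp add: dot_square_norm)
  define c where "c = (\<lambda>t::real. cos t *\<^sub>R p + sin t *\<^sub>R w)"
  have cS: "c t \<in> S3" for t
  proof -
    have "c t \<bullet> c t = 1"
      by (simp add: c_def inner_add_left inner_add_right wp nw pp flip: power2_eq_square)
    then show ?thesis by (simp add: norm_eq_sqrt_inner)
  qed
  have c0: "c 0 = p" by (simp add: c_def)
  have dc: "(c has_derivative (\<lambda>t. t *\<^sub>R w)) (at 0)"
    unfolding c_def by (auto intro!: derivative_eq_intros)
  have key: "((\<lambda>t. f (c t)) has_derivative (\<lambda>t. g (t *\<^sub>R w))) (at 0)"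
    if g: "(f has_derivative g) (at p within S3)" for g
  proof (rule has_derivative_in_compose[OF dc])
    show "(f has_derivative g) (at (c 0) within range c)"
      unfolding c0 by (rule has_derivative_subset[OF g]) (use cS in blast)
  qed
  have "f differentiable (at p within S3)" using f by (auto simp: differentiable_def)
  then have g: "(f has_derivative frechet_derivative f (at p within S3)) (at p within S3)"
    by (simp add: frechet_derivative_works)
  have "(\<lambda>t. f' (t *\<^sub>R w)) = (\<lambda>t. frechet_derivative f (at p within S3) (t *\<^sub>R w))"
    by (rule has_derivative_unique[OF key[OF f] key[OF g]])
  then have "f' (norm v *\<^sub>R w) = frechet_derivative f (at p within S3) (norm v *\<^sub>R w)"
    by (rule fun_cong)
  then show ?thesis using False by (simp add: w_def D_S_def)
qed

text \<open>A tangent field extending the tangent part of \<open>v\<close>. It is used to evaluate tensorial expressions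
  in vector fields on individual tangent vectors; by tensoriality the choice of the extension is
  immaterial.\<close>

definition ext :: "real^4 \<Rightarrow> real^4 \<Rightarrow> real^4" where
  "ext v = (\<lambda>q. tproj q v)"

text \<open>Some orthonormal basis of the tangent space at \<open>p\<close>; it is used only for full contractions, which
  do not depend on the choice.\<close>

definition onb :: "real^4 \<Rightarrow> (real^4) set" where
  "onb p = (SOME B. B \<subseteq> tangent p \<and> pairwise orthogonal B \<and> (\<forall>b\<in>B. norm b = 1) \<and> span B = tangent p)"

text \<open>Integration against the Riemannian volume of the sphere: in polar coordinates the integral of
  \<open>f (x / norm x)\<close> over the unit ball is the integral of \<open>r ^ 3\<close> over \<open>[0, 1]\<close>, i.e. one fourth,
  times the integral of \<open>f\<close> over the sphere.\<close>

definition integral_S3 :: "(real^4 \<Rightarrow> real) \<Rightarrow> real" where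
  "integral_S3 f = 4 * set_lebesgue_integral lborel (ball 0 1) (\<lambda>x. f (sgn x))"

section \<open>Levi-Civita and Bismut connections\<close>

text \<open>The Levi-Civita connection of the induced metric is the tangential part of the ambient
  derivative; it is torsion-free and metric by the two lemmas that follow.\<close>

definition nabla :: "(real^4 \<Rightarrow> real^4) \<Rightarrow> (real^4 \<Rightarrow> real^4) \<Rightarrow> real^4 \<Rightarrow> real^4" where
  "nabla X Y p = tproj p (D_S Y p (X p))"

definition lie_bracket :: "(real^4 \<Rightarrow> real^4) \<Rightarrow> (real^4 \<Rightarrow> real^4) \<Rightarrow> real^4 \<Rightarrow> real^4" where
  "lie_bracket X Y p = D_S Y p (X p) - D_S X p (Y p)"

lemma smooth_S3_has_derivative:
  assumes "smooth_S3 f" "p \<in> S3"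
  shows "(f has_derivative D_S f p) (at p within S3)"
proof -
  obtain U F where U: "open U" "S3 \<subseteq> U" "\<forall>k. Ck k U F" "\<forall>p\<in>S3. F p = f p"
    using assms(1) unfolding smooth_S3_def by blast
  have "Ck (Suc 0) U F" using U(3) by blast
  then have "F differentiable_on U" by simp
  then have "F differentiable (at p within S3)"
    using U(2) assms(2) unfolding differentiable_on_def
    by (meson differentiable_within_subset subsetD)
  then have "f differentiable (at p within S3)"
    by (rule differentiable_transform_within[of _ _ _ 1]) (use U(4) assms(2) in auto)
  moreover have "D_S f p = frechet_derivative f (at p within S3)"
    by (simp add: D_S_def fun_eq_iff)
  ultimately show ?thesis by (simp add: frechet_derivative_works)
qed

lemma D_S_inner:
  assumes "smooth_S3 Y" "smooth_S3 Z" "p \<in> S3" "v \<in> tangent p"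
  shows "D_S (\<lambda>q. Y q \<bullet> Z q) p v = Y p \<bullet> D_S Z p v + D_S Y p v \<bullet> Z p"
proof -
  have "((\<lambda>q. Y q \<bullet> Z q) has_derivative (\<lambda>h. Y p \<bullet> D_S Z p h + D_S Y p h \<bullet> Z p)) (at p within S3)"
    by (rule has_derivative_inner) (use assms smooth_S3_has_derivative in blast)+
  then show ?thesis using D_S_eq[OF _ assms(3,4)] by blast
qed

lemma nabla_metric:
  assumes "smooth_vfield X" "smooth_vfield Y" "smooth_vfield Z" "p \<in> S3"
  shows "D_S (\<lambda>q. Y q \<bullet> Z q) p (X p) = nabla X Y p \<bullet> Z p + Y p \<bullet> nabla X Z p"
proof -
  have "Y p \<bullet> p = 0" "p \<bullet> Z p = 0"
    using assms by (auto simp: smooth_vfield_def tangent_def inner_commute)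
  moreover have "D_S (\<lambda>q. Y q \<bullet> Z q) p (X p) = Y p \<bullet> D_S Z p (X p) + D_S Y p (X p) \<bullet> Z p"
    by (rule D_S_inner) (use assms in \<open>auto simp: smooth_vfield_def\<close>)
  ultimately show ?thesis
    by (simp add: nabla_def tproj_def inner_diff_left inner_diff_right)
qed

lemma nabla_torsion_free:
  assumes "smooth_vfield X" "smooth_vfield Y" "p \<in> S3"
  shows "nabla X Y p - nabla Y X p = lie_bracket X Y p"
proof -
  have normal: "D_S W p v \<bullet> p = - (W p \<bullet> v)" if W: "smooth_vfield W" and v: "v \<in> tangent p" for W v
  proof -
    have "((\<lambda>q. W q \<bullet> q) has_derivative (\<lambda>h. W p \<bullet> h + D_S W p h \<bullet> p)) (at p within S3)"
      by (rule has_derivative_inner[OF smooth_S3_has_derivative has_derivative_ident])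
        (use W assms(3) in \<open>auto simp: smooth_vfield_def\<close>)
    moreover have "((\<lambda>q. W q \<bullet> q) has_derivative (\<lambda>h. 0)) (at p within S3)"
      by (rule has_derivative_transform[OF assms(3) _ has_derivative_const[of 0]])
        (use W in \<open>auto simp: smooth_vfield_def tangent_def\<close>)
    ultimately have "W p \<bullet> v + D_S W p v \<bullet> p = 0"
      using D_S_eq[OF _ assms(3) v] by (metis (no_types, lifting))
    then show ?thesis by linarith
  qed
  have "X p \<in> tangent p" "Y p \<in> tangent p" using assms by (auto simp: smooth_vfield_def)
  then have "D_S Y p (X p) \<bullet> p = D_S X p (Y p) \<bullet> p"
    using normal[OF assms(2), of "X p"] normal[OF assms(1), of "Y p"] by (simp add: inner_commute)
  then show ?thesis by (simp add: nabla_def tproj_def lie_bracket_def)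
qed

type_synonym tensor2 = "real^4 \<Rightarrow> real^4 \<Rightarrow> real^4 \<Rightarrow> real"
type_synonym tensor3 = "real^4 \<Rightarrow> real^4 \<Rightarrow> real^4 \<Rightarrow> real^4 \<Rightarrow> real"

text \<open>The volume form for the orientation by the outward unit normal.\<close>

definition dV :: tensor3 where
  "dV p x y z = det (vector [p, x, y, z] :: real^4^4)"

definition H :: tensor3 where
  "H p x y z = 2 * dV p x y z"

text \<open>\<open>bismut 1\<close> and \<open>bismut (-1)\<close> are the Bismut connections with torsion \<open>H\<close> and \<open>- H\<close>.\<close>

definition bismut :: "real \<Rightarrow> (real^4 \<Rightarrow> real^4) \<Rightarrow> (real^4 \<Rightarrow> real^4) \<Rightarrow> real^4 \<Rightarrow> real^4" where
  "bismut s X Y p = (THE w. w \<in> tangent p \<and>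
     (\<forall>z\<in>tangent p. w \<bullet> z = nabla X Y p \<bullet> z + s * (1/2) * H p (X p) (Y p) z))"

abbreviation nabla_plus where "nabla_plus \<equiv> bismut 1"
abbreviation nabla_minus where "nabla_minus \<equiv> bismut (-1)"

text \<open>The component \<open>R i j k l\<close> is the inner product of \<open>R(e_i, e_j) e_k\<close> with \<open>e_l\<close>, so that the Ricci
  tensor is the contraction of the first with the last index.\<close>

definition Rm_plus :: "real^4 \<Rightarrow> real^4 \<Rightarrow> real^4 \<Rightarrow> real^4 \<Rightarrow> real^4 \<Rightarrow> real" where
  "Rm_plus p x y z w =
     (let X = ext x; Y = ext y; Z = ext z in
       (nabla_plus X (nabla_plus Y Z) p - nabla_plus Y (nabla_plus X Z) p
         - nabla_plus (lie_bracket X Y) Z p) \<bullet> w)"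

definition ring_Rm_plus :: "tensor2 \<Rightarrow> tensor2" where
  "ring_Rm_plus \<gamma> p y z = (\<Sum>i\<in>onb p. \<Sum>l\<in>onb p. Rm_plus p i y z l * \<gamma> p i l)"

section \<open>Operators on tensors\<close>

text \<open>Smooth 2-tensors on the sphere (no symmetry is assumed). So that each tensor has exactly one
  representative, a bilinear form on the tangent space at \<open>p\<close> is extended to the ambient space by
  letting it vanish in the normal direction \<open>p\<close>, and a tensor is zero off the sphere.\<close>

definition smooth_tensor2 :: "tensor2 \<Rightarrow> bool" where
  "smooth_tensor2 \<gamma> \<longleftrightarrow>
     (\<forall>p. bilinear (\<gamma> p)) \<and>
     (\<forall>p\<in>S3. \<forall>v. \<gamma> p p v = 0 \<and> \<gamma> p v p = 0) \<and>
     (\<forall>p. p \<notin> S3 \<longrightarrow> (\<forall>v w. \<gamma> p v w = 0)) \<and>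
     (\<forall>X Y. smooth_vfield X \<longrightarrow> smooth_vfield Y \<longrightarrow> smooth_S3 (\<lambda>p. \<gamma> p (X p) (Y p)))"

definition hessian :: "(real^4 \<Rightarrow> real) \<Rightarrow> tensor2" where
  "hessian u p y z =
     (let Y = ext y; Z = ext z in D_S (\<lambda>q. D_S u q (Z q)) p (Y p) - D_S u p (nabla Y Z p))"

definition nabla3 :: "tensor3 \<Rightarrow> real^4 \<Rightarrow> real^4 \<Rightarrow> real^4 \<Rightarrow> real^4 \<Rightarrow> real^4 \<Rightarrow> real" where
  "nabla3 T p v x y z =
     (let V = ext v; X = ext x; Y = ext y; Z = ext z in
       D_S (\<lambda>q. T q (X q) (Y q) (Z q)) p (V p)
       - T p (nabla V X p) (Y p) (Z p) - T p (X p) (nabla V Y p) (Z p) - T p (X p) (Y p) (nabla V Z p))"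

definition codiff3 :: "tensor3 \<Rightarrow> tensor2" where
  "codiff3 T p y z = - (\<Sum>l\<in>onb p. nabla3 T p l l y z)"

text \<open>The mixed connection; \<open>nabla_bar \<gamma> p v y z\<close> is the derivative in direction \<open>v\<close>, evaluated on
  \<open>y\<close> and \<open>z\<close>.\<close>

definition nabla_bar :: "tensor2 \<Rightarrow> tensor3" where
  "nabla_bar \<gamma> p v y z =
     (let V = ext v; Y = ext y; Z = ext z in
       D_S (\<lambda>q. \<gamma> q (Y q) (Z q)) p (V p)
       - \<gamma> p (nabla_minus V Y p) (Z p) - \<gamma> p (Y p) (nabla_plus V Z p))"

definition L2_inner2 :: "tensor2 \<Rightarrow> tensor2 \<Rightarrow> real" where
  "L2_inner2 \<beta> \<eta> = integral_S3 (\<lambda>p. \<Sum>i\<in>onb p. \<Sum>j\<in>onb p. \<beta> p i j * \<eta> p i j)"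

definition L2_inner3 :: "tensor3 \<Rightarrow> tensor3 \<Rightarrow> real" where
  "L2_inner3 S T =
     integral_S3 (\<lambda>p. \<Sum>i\<in>onb p. \<Sum>j\<in>onb p. \<Sum>k\<in>onb p. S p i j k * T p i j k)"

definition nabla_bar_adj :: "tensor3 \<Rightarrow> tensor2" where
  "nabla_bar_adj T = (THE \<beta>. smooth_tensor2 \<beta> \<and>
     (\<forall>\<eta>. smooth_tensor2 \<eta> \<longrightarrow> L2_inner2 \<beta> \<eta> = L2_inner3 T (nabla_bar \<eta>)))"

definition laplacian_bar :: "tensor2 \<Rightarrow> tensor2" where
  "laplacian_bar \<gamma> p y z = - nabla_bar_adj (nabla_bar \<gamma>) p y z"

definition B_op :: "tensor2 \<Rightarrow> tensor2" where
  "B_op \<gamma> p y z = - (1/2) * laplacian_bar \<gamma> p y z - ring_Rm_plus \<gamma> p y z"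

definition essential_deformation :: "tensor2 \<Rightarrow> bool" where
  "essential_deformation \<gamma> \<longleftrightarrow>
     smooth_tensor2 \<gamma> \<and>
     (\<forall>p\<in>S3. \<forall>y\<in>tangent p. \<forall>z\<in>tangent p. B_op \<gamma> p y z = 0) \<and>
     (\<forall>p\<in>S3. \<forall>l\<in>tangent p. (\<Sum>m\<in>onb p. nabla_bar \<gamma> p m m l) = 0) \<and>
     (\<forall>p\<in>S3. \<forall>l\<in>tangent p. (\<Sum>m\<in>onb p. nabla_bar \<gamma> p m l m) = 0)"

definition restrict_S3 :: "(real^4 \<Rightarrow> real) \<Rightarrow> real^4 \<Rightarrow> real" where
  "restrict_S3 f = (\<lambda>p. if p \<in> S3 then f p else 0)"

end

theory Submission
  imports Defs
begin

text \<open>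
  The sphere is the group of unit quaternions. Left products \<open>a p\<close> with imaginary \<open>a\<close> give a global
  orthonormal frame \<open>lframe\<close> that is parallel for \<open>nabla_plus\<close>, and right products \<open>p a\<close> a frame \<open>rframe\<close>
  that is parallel for \<open>nabla_minus\<close> (\<open>nabla_plus_lmul\<close>, \<open>nabla_minus_rmul\<close>). Both facts come from one
  identity between the volume form and quaternion products, with opposite signs on the two sides.
  Consequently \<open>nabla_plus\<close> is flat, and a tensor \<open>\<gamma>\<close> is given by its nine coefficient functions
  \<open>\<gamma> p (rframe p a) (lframe p b)\<close>, on which the mixed connection acts as the plain derivative
  (\<open>nabla_bar_eq\<close>).

  The fields of the frame generate rotations, which preserve the integral over the sphere, so derivatives
  along them integrate to zero. Integration by parts then identifies the adjoint: the composition
  \<open>nabla_bar_adj (nabla_bar \<gamma>)\<close> applies minus the Laplacian to each coefficient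
  (\<open>nabla_bar_adj_nabla_bar\<close>). As the curvature term vanishes, \<open>B_op \<gamma> = 0\<close> forces, after pairing with
  \<open>\<gamma>\<close>, that \<open>nabla_bar \<gamma> = 0\<close>: the coefficients are constant. Conversely parallel tensors satisfy all
  the conditions, so the essential deformations are parametrized linearly and injectively by the real
  \<open>3 \<times> 3\<close> matrices, a space of dimension nine.

  It remains to write the parallel tensor with coefficient matrix \<open>C\<close> in the stated form. Comparing traces
  suggests that \<open>u\<close> be a quarter of its trace, which is a quadratic form \<open>p \<bullet> S p\<close> with \<open>S\<close> a combination of
  products of left and right multiplications. These are symmetric and traceless, so \<open>u\<close> is a combination
  of the nine listed quadratic harmonics (\<open>potential_in_span\<close>). The Hessian and the codifferential of such a \<open>u\<close>
  are explicit in \<open>S\<close>, and the formula reduces to \<open>frame_product_identity\<close>, a consequence of the Clifford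
  relations.
\<close>

section \<open>Quaternion multiplication and the volume form\<close>

text \<open>A vector \<open>p\<close> of \<open>real^4\<close> stands for the quaternion \<open>p$1 + p$2 i + p$3 j + p$4 k\<close> and \<open>a\<close> for the
  imaginary quaternion \<open>a$1 i + a$2 j + a$3 k\<close>; \<open>lmul a p\<close> and \<open>rmul a p\<close> are the products \<open>a p\<close> and
  \<open>p a\<close>.\<close>

definition lmul :: "real^3 \<Rightarrow> real^4 \<Rightarrow> real^4" where
  "lmul a p = vector
     [- a$1 * p$2 - a$2 * p$3 - a$3 * p$4,
        a$1 * p$1 + a$2 * p$4 - a$3 * p$3,
        a$2 * p$1 + a$3 * p$2 - a$1 * p$4,
        a$3 * p$1 + a$1 * p$3 - a$2 * p$2]"

definition rmul :: "real^3 \<Rightarrow> real^4 \<Rightarrow> real^4" where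
  "rmul a p = vector
     [- a$1 * p$2 - a$2 * p$3 - a$3 * p$4,
        a$1 * p$1 - a$2 * p$4 + a$3 * p$3,
        a$2 * p$1 - a$3 * p$2 + a$1 * p$4,
        a$3 * p$1 - a$1 * p$3 + a$2 * p$2]"

lemma vec4_nth [simp]:
  "(vector [a, b, c, d] :: 'a::zero^4) $ 1 = a" "(vector [a, b, c, d] :: 'a^4) $ 2 = b"
  "(vector [a, b, c, d] :: 'a^4) $ 3 = c" "(vector [a, b, c, d] :: 'a^4) $ 4 = d"
  by (simp_all add: vector_def)

lemma inner4: "(x::real^4) \<bullet> y = x$1 * y$1 + x$2 * y$2 + x$3 * y$3 + x$4 * y$4"
  by (simp add: inner_vec_def sum_4)

lemma inner3: "(x::real^3) \<bullet> y = x$1 * y$1 + x$2 * y$2 + x$3 * y$3"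
  by (simp add: inner_vec_def sum_3)

lemma det_4:
  fixes A :: "real^4^4"
  shows "det A =
    A$1$1 * (A$2$2 * (A$3$3 * A$4$4 - A$3$4 * A$4$3) - A$2$3 * (A$3$2 * A$4$4 - A$3$4 * A$4$2)
           + A$2$4 * (A$3$2 * A$4$3 - A$3$3 * A$4$2))
  - A$1$2 * (A$2$1 * (A$3$3 * A$4$4 - A$3$4 * A$4$3) - A$2$3 * (A$3$1 * A$4$4 - A$3$4 * A$4$1)
           + A$2$4 * (A$3$1 * A$4$3 - A$3$3 * A$4$1))
  + A$1$3 * (A$2$1 * (A$3$2 * A$4$4 - A$3$4 * A$4$2) - A$2$2 * (A$3$1 * A$4$4 - A$3$4 * A$4$1)
           + A$2$4 * (A$3$1 * A$4$2 - A$3$2 * A$4$1))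
  - A$1$4 * (A$2$1 * (A$3$2 * A$4$3 - A$3$3 * A$4$2) - A$2$2 * (A$3$1 * A$4$3 - A$3$3 * A$4$1)
           + A$2$3 * (A$3$1 * A$4$2 - A$3$2 * A$4$1))"
proof -
  have f: "finite {2::4, 3, 4}" "1 \<notin> {2::4, 3, 4}" "finite {3::4, 4}" "2 \<notin> {3::4, 4}"
    "finite {4::4}" "3 \<notin> {4::4}"
    by auto
  show ?thesis
    unfolding det_def UNIV_4
    unfolding sum_over_permutations_insert[OF f(1,2)]
    unfolding sum_over_permutations_insert[OF f(3,4)]
    unfolding sum_over_permutations_insert[OF f(5,6)]
    unfolding permutes_sing
    by (simp add: sign_swap_id permutation_swap_id permutation_compose sign_compose sign_id
        swap_id_eq algebra_simps)
qed

lemma linear_lmul: "linear (lmul a)" and linear_rmul: "linear (rmul a)"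
  by (auto intro!: linearI simp: lmul_def rmul_def vec_eq_iff forall_4 algebra_simps)

lemma linear_lmul_left: "linear (\<lambda>a. lmul a p)"
  by (auto intro!: linearI simp: lmul_def vec_eq_iff forall_4 algebra_simps)

lemma lmul_skew: "lmul a x \<bullet> y = - (x \<bullet> lmul a y)"
  and rmul_skew: "rmul a x \<bullet> y = - (x \<bullet> rmul a y)"
  by (simp_all add: lmul_def rmul_def inner4 algebra_simps)

lemma lmul_rmul_commute: "lmul a (rmul b p) = rmul b (lmul a p)"
  by (simp add: lmul_def rmul_def vec_eq_iff forall_4 algebra_simps)

text \<open>Polarized form of the rule that an imaginary quaternion \<open>a\<close> has square \<open>- (a \<bullet> a)\<close>.\<close>

lemma lmul_clifford: "lmul a (lmul b p) + lmul b (lmul a p) = (-2 * (a \<bullet> b)) *\<^sub>R p"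
  by (simp add: lmul_def inner3 vec_eq_iff forall_4 algebra_simps)

text \<open>For a unit vector \<open>p\<close> the three products with \<open>i\<close>, \<open>j\<close>, \<open>k\<close> complete \<open>p\<close> to an orthonormal basis.
  Stated homogeneously in \<open>p\<close>, this and the two identities that follow are polynomial identities.\<close>

lemma lmul_complete: "(\<Sum>i\<in>UNIV. (v \<bullet> lmul (axis i 1) p) *\<^sub>R lmul (axis i 1) p) = (p \<bullet> p) *\<^sub>R v - (v \<bullet> p) *\<^sub>R p"
  and rmul_complete: "(\<Sum>i\<in>UNIV. (v \<bullet> rmul (axis i 1) p) *\<^sub>R rmul (axis i 1) p) = (p \<bullet> p) *\<^sub>R v - (v \<bullet> p) *\<^sub>R p"
  by (simp_all add: lmul_def rmul_def inner4 sum_3 vec_eq_iff forall_4 axis_def algebra_simps)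

text \<open>At a unit vector \<open>p\<close> and for tangent \<open>v\<close> and \<open>z\<close> only the first term on the right survives: the
  derivative of the field \<open>lmul a\<close> in direction \<open>v\<close> is then cancelled by a torsion \<open>2 dV\<close>, and that of
  \<open>rmul a\<close> by the opposite torsion. This sign is what makes one family of fields parallel for
  \<open>nabla_plus\<close> and the other for \<open>nabla_minus\<close>.\<close>

lemma dV_lmul: "dV p v z (lmul a p) = (p \<bullet> p) * (z \<bullet> lmul a v) - (v \<bullet> p) * (z \<bullet> lmul a p) + (z \<bullet> p) * (v \<bullet> lmul a p)"
  unfolding dV_def det_4 by (simp add: lmul_def inner4 algebra_simps)
lemma dV_rmul: "dV p v z (rmul a p) = - (p \<bullet> p) * (z \<bullet> rmul a v) + (v \<bullet> p) * (z \<bullet> rmul a p) - (z \<bullet> p) * (v \<bullet> rmul a p)"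
  unfolding dV_def det_4 by (simp add: rmul_def inner4 algebra_simps)

lemma dV_linear: "linear (\<lambda>x. dV p x y z)" "linear (\<lambda>y. dV p x y z)" "linear (\<lambda>z. dV p x y z)"
  unfolding dV_def det_4 by (auto intro!: linearI simp: algebra_simps)

lemma dV_alt: "dV p p y z = 0" "dV p x p z = 0" "dV p x y p = 0" "dV p x x z = 0"
  unfolding dV_def det_4 by (auto simp: algebra_simps)

section \<open>Calculus of smooth functions on the sphere\<close>

lemma Ck_cong:
  assumes "open U" "\<And>x. x \<in> U \<Longrightarrow> f x = g x" "Ck k U f"
  shows "Ck k U g"
  using assms(2,3)
proof (induction k arbitrary: f g)
  case 0
  have "continuous_on U f" using 0(2) unfolding Ck.simps(1) .
  then have "continuous_on U g" by (rule continuous_on_eq) (rule 0(1))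
  then show ?case unfolding Ck.simps(1) .
next
  case (Suc k)
  have f: "f differentiable (at x)" if "x \<in> U" for x
    using Suc.prems(2) that assms(1) by (auto simp: differentiable_on_eq_differentiable_at)
  have d: "frechet_derivative f (at x) = frechet_derivative g (at x)" if "x \<in> U" for x
    using frechet_derivative_transform_within_open[OF f assms(1), of x g] that Suc.prems(1) by auto
  have "g differentiable (at x within U)" if "x \<in> U" for x
    using differentiable_transform_within[OF _ zero_less_one that, of f g] Suc.prems that
    by (simp add: differentiable_on_def)
  then have "g differentiable_on U" by (simp add: differentiable_on_def)
  moreover have "Ck k U (\<lambda>x. frechet_derivative g (at x) v)" for v
  proof (rule Suc.IH)
    show "Ck k U (\<lambda>x. frechet_derivative f (at x) v)" using Suc.prems(2) by simp
  qed (simp add: d)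
  ultimately show ?case by simp
qed

lemma Ck_SucI:
  assumes "open U" "\<And>x. x \<in> U \<Longrightarrow> (f has_derivative f' x) (at x)"
    and "\<And>v. Ck k U (\<lambda>x. f' x v)"
  shows "Ck (Suc k) U f"
proof -
  have "f differentiable_on U"
    using assms(1,2) by (auto simp: differentiable_on_eq_differentiable_at differentiable_def)
  moreover have "Ck k U (\<lambda>x. frechet_derivative f (at x) v)" for v
  proof (rule Ck_cong[OF assms(1) _ assms(3)[of v]])
    show "f' x v = frechet_derivative f (at x) v" if "x \<in> U" for x
      using frechet_derivative_at[OF assms(2)[OF that]] by simp
  qed
  ultimately show ?thesis by simp
qed

lemma Ck_has_derivative:
  assumes "open U" "Ck (Suc k) U f" "x \<in> U"
  shows "(f has_derivative frechet_derivative f (at x)) (at x)"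
  using assms by (auto simp: differentiable_on_eq_differentiable_at frechet_derivative_works)

lemma Ck_Suc_lower: "Ck (Suc k) U f \<Longrightarrow> Ck k U f"
proof (induction k arbitrary: f)
  case 0 then show ?case by (simp add: differentiable_imp_continuous_on)
next
  case (Suc k) then show ?case unfolding Ck.simps(2)[of "Suc k"] Ck.simps(2)[of k U f] by blast
qed

lemma Ck_subset:
  assumes "V \<subseteq> U" "Ck k U f" shows "Ck k V f"
  using assms(2)
proof (induction k arbitrary: f)
  case 0 then show ?case using continuous_on_subset[OF _ assms(1), of f] by simp
next
  case (Suc k) then show ?case using differentiable_on_subset[OF _ assms(1), of f] by simp
qed

lemma Ck_const: "open U \<Longrightarrow> Ck k U (\<lambda>x. c)"
proof (induction k arbitrary: c)
  case (Suc k) then show ?case by (intro Ck_SucI[where f'="\<lambda>x v. 0"]) auto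
qed simp

lemma Ck_linear: "open U \<Longrightarrow> bounded_linear f \<Longrightarrow> Ck k U f"
proof (induction k)
  case 0 then show ?case by (simp add: linear_continuous_on)
next
  case (Suc k) then show ?case
    by (intro Ck_SucI[where f'="\<lambda>x. f"]) (auto simp: bounded_linear_imp_has_derivative Ck_const)
qed

lemma Ck_add: "open U \<Longrightarrow> Ck k U f \<Longrightarrow> Ck k U g \<Longrightarrow> Ck k U (\<lambda>x. f x + g x)"
proof (induction k arbitrary: f g)
  case 0 then show ?case by (simp add: continuous_on_add)
next
  case (Suc k)
  show ?case
  proof (rule Ck_SucI[OF \<open>open U\<close>])
    show "((\<lambda>x. f x + g x) has_derivative
        (\<lambda>v. frechet_derivative f (at x) v + frechet_derivative g (at x) v)) (at x)" if "x \<in> U" for x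
      by (rule has_derivative_add[OF Suc.prems(2,3)[THEN Ck_has_derivative[OF \<open>open U\<close> _ that]]])
    show "Ck k U (\<lambda>x. frechet_derivative f (at x) v + frechet_derivative g (at x) v)" for v
      by (rule Suc.IH) (use Suc.prems in simp_all)
  qed
qed

lemma Ck_bilinear:
  assumes "bounded_bilinear b" "open U"
  shows "Ck k U f \<Longrightarrow> Ck k U g \<Longrightarrow> Ck k U (\<lambda>x. b (f x) (g x))"
proof (induction k arbitrary: f g)
  case 0 then show ?case by (simp add: bounded_bilinear.continuous_on[OF assms(1)])
next
  case (Suc k)
  show ?case
  proof (rule Ck_SucI[OF assms(2)])
    show "((\<lambda>x. b (f x) (g x)) has_derivative
        (\<lambda>v. b (f x) (frechet_derivative g (at x) v) + b (frechet_derivative f (at x) v) (g x))) (at x)"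
      if "x \<in> U" for x
      by (rule bounded_bilinear.FDERIV[OF assms(1) Suc.prems[THEN Ck_has_derivative[OF assms(2) _ that]]])
    have "Ck k U (\<lambda>x. frechet_derivative f (at x) v)" "Ck k U (\<lambda>x. frechet_derivative g (at x) v)" for v
      using Suc.prems by simp_all
    then show "Ck k U (\<lambda>x. b (f x) (frechet_derivative g (at x) v) + b (frechet_derivative f (at x) v) (g x))" for v
      by (intro Ck_add[OF assms(2)] Suc.IH Suc.prems[THEN Ck_Suc_lower])
  qed
qed

lemma smooth_S3_cong:
  assumes "smooth_S3 f" "\<And>p. p \<in> S3 \<Longrightarrow> f p = g p" shows "smooth_S3 g"
  using assms unfolding smooth_S3_def by metis

lemma smooth_S3_const: "smooth_S3 (\<lambda>p. c)"
  unfolding smooth_S3_def by (rule exI[of _ UNIV]) (auto intro: Ck_const)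

lemma smooth_S3_linear: "linear f \<Longrightarrow> smooth_S3 f"
  for f :: "real^4 \<Rightarrow> 'b::real_normed_vector"
  unfolding smooth_S3_def by (rule exI[of _ UNIV]) (auto intro: Ck_linear simp: linear_conv_bounded_linear)

lemma smooth_S3_bilinear:
  assumes "bounded_bilinear b" "smooth_S3 f" "smooth_S3 g"
  shows "smooth_S3 (\<lambda>p. b (f p) (g p))"
proof -
  obtain U F V G where *: "open U" "S3 \<subseteq> U" "\<And>k. Ck k U F" "\<forall>p\<in>S3. F p = f p"
    "open V" "S3 \<subseteq> V" "\<And>k. Ck k V G" "\<forall>p\<in>S3. G p = g p"
    using assms(2,3) unfolding smooth_S3_def by metis
  have "Ck k (U \<inter> V) (\<lambda>p. b (F p) (G p))" for k
    by (intro Ck_bilinear[OF assms(1) open_Int] * Ck_subset[OF Int_lower1 *(3)] Ck_subset[OF Int_lower2 *(7)])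
  then show ?thesis
    unfolding smooth_S3_def using * by (intro exI[of _ "U \<inter> V"] exI[of _ "\<lambda>p. b (F p) (G p)"]) auto
qed

lemmas smooth_S3_mult = smooth_S3_bilinear[OF bounded_bilinear_mult]
lemmas smooth_S3_inner = smooth_S3_bilinear[OF bounded_bilinear_inner]
lemmas smooth_S3_scaleR = smooth_S3_bilinear[OF bounded_bilinear_scaleR]

lemma smooth_S3_add:
  assumes "smooth_S3 f" "smooth_S3 g"
  shows "smooth_S3 (\<lambda>p. f p + g p)"
proof -
  obtain U F V G where *: "open U" "S3 \<subseteq> U" "\<And>k. Ck k U F" "\<forall>p\<in>S3. F p = f p"
    "open V" "S3 \<subseteq> V" "\<And>k. Ck k V G" "\<forall>p\<in>S3. G p = g p"
    using assms unfolding smooth_S3_def by metis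
  have "Ck k (U \<inter> V) (\<lambda>p. F p + G p)" for k
    by (intro Ck_add open_Int * Ck_subset[OF Int_lower1 *(3)] Ck_subset[OF Int_lower2 *(7)])
  then show ?thesis
    unfolding smooth_S3_def using * by (intro exI[of _ "U \<inter> V"] exI[of _ "\<lambda>p. F p + G p"]) auto
qed

lemma smooth_S3_sum: "(\<And>i. i \<in> I \<Longrightarrow> smooth_S3 (f i)) \<Longrightarrow> smooth_S3 (\<lambda>p. \<Sum>i\<in>I. f i p)"
  by (induction I rule: infinite_finite_induct) (auto intro: smooth_S3_const smooth_S3_add)

lemma smooth_S3_uminus: "smooth_S3 f \<Longrightarrow> smooth_S3 (\<lambda>p. - f p)"
  using smooth_S3_scaleR[OF smooth_S3_const[of "-1"], of f] by simp

lemma smooth_S3_diff: "smooth_S3 f \<Longrightarrow> smooth_S3 g \<Longrightarrow> smooth_S3 (\<lambda>p. f p - g p)"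
  using smooth_S3_add[of f "\<lambda>p. - g p"] smooth_S3_uminus[of g] by simp

text \<open>Since \<open>M\<close> is tangent to the sphere, the derivative may be taken of any smooth ambient extension, where
  it is a combination of partial derivatives with coefficients linear in the point.\<close>

lemma smooth_S3_D_S:
  fixes f :: "real^4 \<Rightarrow> 'b::real_normed_vector"
  assumes f: "smooth_S3 f" and M: "linear M" "\<And>p. p \<in> S3 \<Longrightarrow> M p \<in> tangent p"
  shows "smooth_S3 (\<lambda>p. D_S f p (M p))"
proof -
  obtain U F where U: "open U" "S3 \<subseteq> U" "\<And>k. Ck k U F" "\<forall>p\<in>S3. F p = f p"
    using f unfolding smooth_S3_def by metis
  have "Ck k U (\<lambda>x. frechet_derivative F (at x) v)" for k v
    using U(3)[of "Suc k"] by simp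
  then have s: "smooth_S3 (\<lambda>x. frechet_derivative F (at x) v)" for v
    using U unfolding smooth_S3_def by blast
  have "smooth_S3 (\<lambda>p. \<Sum>e\<in>Basis. (M p \<bullet> e) *\<^sub>R frechet_derivative F (at p) e)"
    by (intro smooth_S3_sum smooth_S3_scaleR smooth_S3_inner smooth_S3_linear[OF M(1)] smooth_S3_const s)
  then show ?thesis
  proof (rule smooth_S3_cong)
    fix p assume p: "p \<in> S3"
    then have d: "(F has_derivative frechet_derivative F (at p)) (at p)"
      using Ck_has_derivative[OF U(1) U(3)] U(2) by blast
    have "(f has_derivative frechet_derivative F (at p)) (at p within S3)"
      by (rule has_derivative_transform[OF p _ has_derivative_at_withinI[OF d]]) (use U in auto)
    then have "D_S f p (M p) = frechet_derivative F (at p) (M p)"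
      using D_S_eq p M(2) by blast
    also have "\<dots> = frechet_derivative F (at p) (\<Sum>e\<in>Basis. (M p \<bullet> e) *\<^sub>R e)"
      by (simp add: euclidean_representation)
    also have "\<dots> = (\<Sum>e\<in>Basis. (M p \<bullet> e) *\<^sub>R frechet_derivative F (at p) e)"
      using has_derivative_linear[OF d] by (simp add: linear_sum linear_scale)
    finally show "(\<Sum>e\<in>Basis. (M p \<bullet> e) *\<^sub>R frechet_derivative F (at p) e) = D_S f p (M p)" by simp
  qed
qed

lemma smooth_S3_continuous_on: "smooth_S3 f \<Longrightarrow> continuous_on S3 f"
  using has_derivative_continuous[OF smooth_S3_has_derivative] by (auto simp: continuous_on_eq_continuous_within)

lemma D_S_cong:
  assumes "\<And>q. q \<in> S3 \<Longrightarrow> f q = g q" "p \<in> S3"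
  shows "D_S f p = D_S g p"
proof -
  have "(f has_derivative d) (at p within S3) \<longleftrightarrow> (g has_derivative d) (at p within S3)" for d
    using has_derivative_transform[OF assms(2), of g f] has_derivative_transform[OF assms(2), of f g] assms(1)
    by auto
  then show ?thesis by (simp add: D_S_def frechet_derivative_def fun_eq_iff)
qed

lemma D_S_linear_on:
  assumes "smooth_S3 f" "p \<in> S3" shows "linear (D_S f p)"
  using has_derivative_linear[OF smooth_S3_has_derivative[OF assms]] .

lemma D_S_sum:
  assumes "\<And>i. i \<in> I \<Longrightarrow> smooth_S3 (f i)" "p \<in> S3" "v \<in> tangent p"
  shows "D_S (\<lambda>q. \<Sum>i\<in>I. f i q) p v = (\<Sum>i\<in>I. D_S (f i) p v)"
  using D_S_eq[OF has_derivative_sum[OF smooth_S3_has_derivative[OF assms(1) assms(2)]] assms(2,3)] .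

lemma D_S_mult:
  fixes f g :: "real^4 \<Rightarrow> real"
  assumes "smooth_S3 f" "smooth_S3 g" "p \<in> S3" "v \<in> tangent p"
  shows "D_S (\<lambda>q. f q * g q) p v = f p * D_S g p v + D_S f p v * g p"
  using D_S_eq[OF has_derivative_mult[OF assms(1,2)[THEN smooth_S3_has_derivative[OF _ assms(3)]]] assms(3,4)] .

lemma D_S_linear:
  assumes "linear f" "p \<in> S3" "v \<in> tangent p"
  shows "D_S f p v = f v"
  using D_S_eq[OF bounded_linear_imp_has_derivative] assms by (simp add: linear_conv_bounded_linear)

lemma great_circle:
  assumes p: "p \<in> S3" and w: "w \<in> tangent p" "norm w = 1"
  shows "cos t *\<^sub>R p + sin t *\<^sub>R w \<in> S3"
    and "- sin t *\<^sub>R p + cos t *\<^sub>R w \<in> tangent (cos t *\<^sub>R p + sin t *\<^sub>R w)"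
proof -
  have pp: "p \<bullet> p = 1" and ww: "w \<bullet> w = 1" and wp: "w \<bullet> p = 0" "p \<bullet> w = 0"
    using p w by (simp_all add: dot_square_norm tangent_def inner_commute)
  have "(cos t *\<^sub>R p + sin t *\<^sub>R w) \<bullet> (cos t *\<^sub>R p + sin t *\<^sub>R w) = 1"
    by (simp add: inner_add_left inner_add_right wp pp ww flip: power2_eq_square)
  then show "cos t *\<^sub>R p + sin t *\<^sub>R w \<in> S3" by (simp add: norm_eq_sqrt_inner)
  show "- sin t *\<^sub>R p + cos t *\<^sub>R w \<in> tangent (cos t *\<^sub>R p + sin t *\<^sub>R w)"
    by (simp add: tangent_def inner_add_left inner_diff_left inner_add_right wp pp ww)
qed

lemma DERIV_great_circle:
  fixes f :: "real^4 \<Rightarrow> real"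
  assumes f: "smooth_S3 f" and p: "p \<in> S3" and w: "w \<in> tangent p" "norm w = 1"
  shows "((\<lambda>t. f (cos t *\<^sub>R p + sin t *\<^sub>R w)) has_real_derivative
    D_S f (cos t *\<^sub>R p + sin t *\<^sub>R w) (- sin t *\<^sub>R p + cos t *\<^sub>R w)) (at t)"
proof -
  define c where "c = (\<lambda>t. cos t *\<^sub>R p + sin t *\<^sub>R w)"
  define c' where "c' = - sin t *\<^sub>R p + cos t *\<^sub>R w"
  have cS: "c t \<in> S3" for t unfolding c_def by (rule great_circle(1)[OF assms(2-4)])
  have dc: "(c has_derivative (\<lambda>h. h *\<^sub>R c')) (at t)"
    unfolding c_def c'_def by (auto intro!: derivative_eq_intros simp: algebra_simps)
  have "((\<lambda>t. f (c t)) has_derivative (\<lambda>h. D_S f (c t) (h *\<^sub>R c'))) (at t)"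
  proof (rule has_derivative_in_compose[OF dc])
    show "(f has_derivative D_S f (c t)) (at (c t) within range c)"
      by (rule has_derivative_subset[OF smooth_S3_has_derivative[OF f cS]]) (use cS in blast)
  qed
  moreover have "D_S f (c t) (h *\<^sub>R c') = D_S f (c t) c' * h" for h
    using linear_scale[OF D_S_linear_on[OF f cS]] by simp
  ultimately show ?thesis by (simp add: has_field_derivative_def c_def c'_def)
qed

text \<open>Any two points of the sphere lie on a great circle.\<close>

lemma D_S_zero_imp_constant:
  fixes f :: "real^4 \<Rightarrow> real"
  assumes f: "smooth_S3 f" and D: "\<And>p v. p \<in> S3 \<Longrightarrow> v \<in> tangent p \<Longrightarrow> D_S f p v = 0"
    and p: "p \<in> S3" and q: "q \<in> S3"
  shows "f q = f p"
proof -
  define v where "v = q - (q \<bullet> p) *\<^sub>R p"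
  have pq: "p \<bullet> p = 1" "q \<bullet> q = 1" using p q by (simp_all add: dot_square_norm)
  have vt: "v \<in> tangent p" by (simp add: v_def tangent_def inner_diff_left pq)
  have "v \<bullet> v = 1 - (q \<bullet> p)\<^sup>2"
    by (simp add: v_def inner_diff_left inner_diff_right pq inner_commute[of p q] power2_eq_square)
  then have vn: "(q \<bullet> p)\<^sup>2 + (norm v)\<^sup>2 = 1" by (simp add: dot_square_norm)
  obtain w where w: "w \<in> tangent p" "norm w = 1" "v = norm v *\<^sub>R w"
  proof (cases "v = 0")
    case True
    have "lmul (axis 1 1) p \<in> tangent p" "norm (lmul (axis 1 1) p) = 1"
      using pq(1) by (simp_all add: tangent_def norm_eq_sqrt_inner inner4 lmul_def axis_def algebra_simps)
    \<comment> \<open>here \<open>q\<close> is \<open>p\<close> or its antipode, and any great circle through \<open>p\<close> will do\<close>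
    then show thesis using that True by simp
  next
    case False
    then show thesis using that[of "v /\<^sub>R norm v"] vt by (simp add: tangent_def)
  qed
  obtain t where t: "q \<bullet> p = cos t" "norm v = sin t" using sincos_total_2pi[OF vn] by metis
  have "q = cos t *\<^sub>R p + sin t *\<^sub>R w" using w(3) t by (simp add: v_def algebra_simps)
  moreover have "f (cos t *\<^sub>R p + sin t *\<^sub>R w) = f (cos 0 *\<^sub>R p + sin 0 *\<^sub>R w)"
  proof (rule DERIV_isconst_all[of "\<lambda>t. f (cos t *\<^sub>R p + sin t *\<^sub>R w)", rule_format])
    fix x show "((\<lambda>t. f (cos t *\<^sub>R p + sin t *\<^sub>R w)) has_real_derivative 0) (at x)"
      using DERIV_great_circle[OF f p w(1,2), of x] D[OF great_circle[OF p w(1,2)], of x] by simp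
  qed
  ultimately show ?thesis by simp
qed

section \<open>The two parallel frames and the Bismut connections\<close>

lemma S3_inner: "p \<in> S3 \<Longrightarrow> p \<bullet> p = 1"
  by (simp add: dot_square_norm)

lemma lmul_tangent: "lmul a p \<in> tangent p" and rmul_tangent: "rmul a p \<in> tangent p"
  using lmul_skew[of a p p] rmul_skew[of a p p] by (simp_all add: tangent_def inner_commute)

lemma linear_inner_right: "linear f \<Longrightarrow> linear (\<lambda>x. y \<bullet> f x)"
  by (auto intro!: linearI simp: linear_add linear_scale inner_add_right)

lemma subspace_tangent: "subspace (tangent p)"
  by (simp add: tangent_def subspace_def inner_add_left)

definition lframe :: "real^4 \<Rightarrow> 3 \<Rightarrow> real^4" where "lframe p i = lmul (axis i 1) p"
definition rframe :: "real^4 \<Rightarrow> 3 \<Rightarrow> real^4" where "rframe p i = rmul (axis i 1) p"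

lemma linear_lframe: "linear (\<lambda>p. lframe p i)" and linear_rframe: "linear (\<lambda>p. rframe p i)"
  by (simp_all add: lframe_def rframe_def linear_lmul linear_rmul)

lemma lframe_tangent: "lframe p i \<in> tangent p" and rframe_tangent: "rframe p i \<in> tangent p"
  by (simp_all add: lframe_def rframe_def lmul_tangent rmul_tangent)

text \<open>That the vectors span the tangent space is recorded as the expansion formula, the form in which it
  is applied.\<close>

definition tangent_frame :: "real^4 \<Rightarrow> (3 \<Rightarrow> real^4) \<Rightarrow> bool" where
  "tangent_frame p E \<longleftrightarrow> (\<forall>i. E i \<in> tangent p) \<and> (\<forall>i j. E i \<bullet> E j = of_bool (i = j)) \<and>
     (\<forall>v\<in>tangent p. v = (\<Sum>i\<in>UNIV. (v \<bullet> E i) *\<^sub>R E i))"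

lemma inner_lmul_lmul: "lmul a p \<bullet> lmul b p = (a \<bullet> b) * (p \<bullet> p)"
  and inner_rmul_rmul: "rmul a p \<bullet> rmul b p = (a \<bullet> b) * (p \<bullet> p)"
  by (simp_all add: lmul_def rmul_def inner3 inner4 algebra_simps)

lemma tangent_frame_lframe: "p \<in> S3 \<Longrightarrow> tangent_frame p (lframe p)"
  and tangent_frame_rframe: "p \<in> S3 \<Longrightarrow> tangent_frame p (rframe p)"
  unfolding tangent_frame_def
  by (simp_all add: lframe_tangent rframe_tangent)
    (simp_all add: lframe_def rframe_def inner_lmul_lmul inner_rmul_rmul S3_inner inner_axis_axis
      lmul_complete rmul_complete, simp_all add: tangent_def)

lemma vec_expand_lframe: "p \<in> S3 \<Longrightarrow> v = (v \<bullet> p) *\<^sub>R p + (\<Sum>i\<in>UNIV. (v \<bullet> lframe p i) *\<^sub>R lframe p i)"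
  and vec_expand_rframe: "p \<in> S3 \<Longrightarrow> v = (v \<bullet> p) *\<^sub>R p + (\<Sum>i\<in>UNIV. (v \<bullet> rframe p i) *\<^sub>R rframe p i)"
  by (simp_all add: lframe_def rframe_def lmul_complete rmul_complete S3_inner)

lemma linear_tangent_frame:
  assumes "tangent_frame p E" "v \<in> tangent p" "linear F"
  shows "F v = (\<Sum>i\<in>UNIV. (v \<bullet> E i) *\<^sub>R F (E i))"
proof -
  have "F v = F (\<Sum>i\<in>UNIV. (v \<bullet> E i) *\<^sub>R E i)"
    using assms(1,2) unfolding tangent_frame_def by metis
  then show ?thesis using assms(3) by (simp add: linear_sum linear_scale)
qed

lemma onb_props:
  "onb p \<subseteq> tangent p" "pairwise orthogonal (onb p)" "\<And>b. b \<in> onb p \<Longrightarrow> norm b = 1"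
  "span (onb p) = tangent p" "finite (onb p)"
proof -
  obtain B where "B \<subseteq> tangent p" "pairwise orthogonal B" "\<And>x. x \<in> B \<Longrightarrow> norm x = 1" "span B = tangent p"
    using orthonormal_basis_subspace[OF subspace_tangent[of p]] by metis
  then have "\<exists>B. B \<subseteq> tangent p \<and> pairwise orthogonal B \<and> (\<forall>b\<in>B. norm b = 1) \<and> span B = tangent p"
    by blast
  from someI_ex[OF this] show *: "onb p \<subseteq> tangent p" "pairwise orthogonal (onb p)"
    "\<And>b. b \<in> onb p \<Longrightarrow> norm b = 1" "span (onb p) = tangent p"
    unfolding onb_def[symmetric] by blast+
  have "0 \<notin> onb p" using *(3) by force
  then show "finite (onb p)"
    using pairwise_orthogonal_independent[OF *(2)] independent_imp_finite by blast
qed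

lemma onb_parseval:
  assumes "x \<in> tangent p"
  shows "(\<Sum>i\<in>onb p. (i \<bullet> x) * (i \<bullet> y)) = x \<bullet> y"
proof -
  have "x = (\<Sum>i\<in>onb p. (i \<bullet> x) *\<^sub>R i)"
    using orthonormal_basis_expand[of "onb p" x, OF onb_props(2) onb_props(3) _ onb_props(5)] assms onb_props(4)[of p]
    by (simp add: inner_commute)
  then have "x \<bullet> y = (\<Sum>i\<in>onb p. (i \<bullet> x) *\<^sub>R i) \<bullet> y" by metis
  then show ?thesis by (simp add: inner_sum_left)
qed

text \<open>The basis \<open>onb p\<close> is arbitrary, but the trace of a bilinear form may be computed in every orthonormal
  frame; in this way all contractions are carried over to the parallel frames.\<close>

lemma onb_trace:
  fixes G :: "real^4 \<Rightarrow> real^4 \<Rightarrow> real"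
  assumes E: "tangent_frame p E" and l: "\<And>y. linear (\<lambda>x. G x y)" "\<And>x. linear (G x)"
  shows "(\<Sum>i\<in>onb p. G i i) = (\<Sum>k\<in>UNIV. G (E k) (E k))"
proof -
  have "G i i = (\<Sum>k\<in>UNIV. \<Sum>m\<in>UNIV. ((i \<bullet> E k) * (i \<bullet> E m)) * G (E k) (E m))" if "i \<in> onb p" for i
  proof -
    have i: "i \<in> tangent p" using that onb_props(1) by blast
    have "G i i = (\<Sum>k\<in>UNIV. (i \<bullet> E k) * G (E k) i)"
      using linear_tangent_frame[OF E i l(1)] by simp
    also have "\<dots> = (\<Sum>k\<in>UNIV. (i \<bullet> E k) * (\<Sum>m\<in>UNIV. (i \<bullet> E m) * G (E k) (E m)))"
      by (subst linear_tangent_frame[OF E i l(2)]) simp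
    finally show ?thesis by (simp add: sum_distrib_left mult_ac)
  qed
  then have "(\<Sum>i\<in>onb p. G i i) = (\<Sum>i\<in>onb p. \<Sum>k\<in>UNIV. \<Sum>m\<in>UNIV. ((i \<bullet> E k) * (i \<bullet> E m)) * G (E k) (E m))"
    by simp
  also have "\<dots> = (\<Sum>k\<in>UNIV. \<Sum>m\<in>UNIV. \<Sum>i\<in>onb p. ((i \<bullet> E k) * (i \<bullet> E m)) * G (E k) (E m))"
    by (subst sum.swap, rule sum.cong[OF refl], rule sum.swap)
  also have "\<dots> = (\<Sum>k\<in>UNIV. \<Sum>m\<in>UNIV. (E k \<bullet> E m) * G (E k) (E m))"
    using E by (simp add: sum_distrib_right[symmetric] onb_parseval tangent_frame_def)
  also have "\<dots> = (\<Sum>k\<in>UNIV. G (E k) (E k))"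
    using E by (simp add: tangent_frame_def of_bool_def if_distrib[of "\<lambda>c. c * _"] cong: if_cong)
  finally show ?thesis .
qed

lemma dV_lmul_tangent:
  assumes "p \<in> S3" "v \<in> tangent p" "z \<in> tangent p"
  shows "dV p v z (lmul a p) = z \<bullet> lmul a v" "dV p v z (rmul a p) = - (z \<bullet> rmul a v)"
  using assms by (simp_all add: dV_lmul dV_rmul S3_inner tangent_def)

text \<open>The vector described in the definition of \<open>bismut\<close> is the Levi-Civita derivative plus \<open>s\<close> times the
  vector that represents the linear form \<open>dV p (X p) (Y p)\<close>.\<close>

lemma bismut_props:
  assumes p: "p \<in> S3"
  shows "bismut s X Y p \<in> tangent p"
    and "z \<in> tangent p \<Longrightarrow> bismut s X Y p \<bullet> z = nabla X Y p \<bullet> z + s * (1/2) * H p (X p) (Y p) z"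
proof -
  let ?P = "\<lambda>w. w \<in> tangent p \<and> (\<forall>z\<in>tangent p. w \<bullet> z = nabla X Y p \<bullet> z + s * (1/2) * H p (X p) (Y p) z)"
  define c where "c = (\<Sum>b\<in>Basis. dV p (X p) (Y p) b *\<^sub>R b)"
  have c: "c \<bullet> z = dV p (X p) (Y p) z" for z
  proof -
    have "dV p (X p) (Y p) z = dV p (X p) (Y p) (\<Sum>b\<in>Basis. (z \<bullet> b) *\<^sub>R b)"
      by (simp add: euclidean_representation)
    also have "\<dots> = c \<bullet> z"
      by (simp add: c_def inner_sum_left linear_sum[OF dV_linear(3)] linear_scale[OF dV_linear(3)]
          inner_commute[of z] mult.commute)
    finally show ?thesis by simp
  qed
  have "nabla X Y p \<in> tangent p" using p
    by (simp add: nabla_def tproj_def tangent_def inner_diff_left S3_inner)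
  moreover have "c \<in> tangent p" by (simp add: tangent_def c dV_alt)
  ultimately have ex: "?P (nabla X Y p + s *\<^sub>R c)"
    using subspace_tangent[of p]
    by (auto simp: subspace_add subspace_scale inner_add_left c H_def)
  moreover have "w = w'" if "?P w" "?P w'" for w w'
  proof -
    have "w - w' \<in> tangent p" using that subspace_diff[OF subspace_tangent] by blast
    then have "(w - w') \<bullet> (w - w') = 0" using that by (simp add: inner_diff_left)
    then show ?thesis by simp
  qed
  ultimately have "?P (THE w. ?P w)" using theI[of ?P "nabla X Y p + s *\<^sub>R c"] by blast
  then have "?P (bismut s X Y p)" unfolding bismut_def .
  then show "bismut s X Y p \<in> tangent p"
    "z \<in> tangent p \<Longrightarrow> bismut s X Y p \<bullet> z = nabla X Y p \<bullet> z + s * (1/2) * H p (X p) (Y p) z"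
    by blast+
qed

lemma inner_tproj_tangent: "z \<in> tangent p \<Longrightarrow> tproj p v \<bullet> z = v \<bullet> z"
  by (simp add: tproj_def tangent_def inner_diff_left inner_commute[of p])

lemma tproj_tangent: "p \<in> S3 \<Longrightarrow> tproj p v \<in> tangent p"
  by (simp add: tproj_def tangent_def inner_diff_left S3_inner)

lemma tproj_id: "v \<in> tangent p \<Longrightarrow> tproj p v = v"
  by (simp add: tproj_def tangent_def)

text \<open>The fields \<open>lmul a\<close> are parallel for the metric connection \<open>nabla_plus\<close>, and the fields \<open>rmul a\<close> for
  \<open>nabla_minus\<close>: differentiating an inner product with such a field differentiates only the other factor.\<close>

lemma nabla_plus_lmul:
  assumes p: "p \<in> S3" and X: "X p \<in> tangent p" and Y: "smooth_vfield Y"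
  shows "nabla_plus X Y p \<bullet> lmul a p = D_S (\<lambda>q. Y q \<bullet> lmul a q) p (X p)"
proof -
  have Yp: "Y p \<in> tangent p" using p Y by (simp add: smooth_vfield_def)
  have "D_S (\<lambda>q. Y q \<bullet> lmul a q) p (X p) = Y p \<bullet> lmul a (X p) + D_S Y p (X p) \<bullet> lmul a p"
    using D_S_inner[OF _ smooth_S3_linear[OF linear_lmul] p X] Y D_S_linear[OF linear_lmul p X]
    by (simp add: smooth_vfield_def)
  then show ?thesis
    using bismut_props(2)[OF p lmul_tangent, of 1 X Y] dV_lmul_tangent(1)[OF p X Yp]
    by (simp add: nabla_def inner_tproj_tangent lmul_tangent H_def)
qed

lemma nabla_minus_rmul:
  assumes p: "p \<in> S3" and X: "X p \<in> tangent p" and Y: "smooth_vfield Y"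
  shows "nabla_minus X Y p \<bullet> rmul a p = D_S (\<lambda>q. Y q \<bullet> rmul a q) p (X p)"
proof -
  have Yp: "Y p \<in> tangent p" using p Y by (simp add: smooth_vfield_def)
  have "D_S (\<lambda>q. Y q \<bullet> rmul a q) p (X p) = Y p \<bullet> rmul a (X p) + D_S Y p (X p) \<bullet> rmul a p"
    using D_S_inner[OF _ smooth_S3_linear[OF linear_rmul] p X] Y D_S_linear[OF linear_rmul p X]
    by (simp add: smooth_vfield_def)
  then show ?thesis
    using bismut_props(2)[OF p rmul_tangent, of "-1" X Y] dV_lmul_tangent(2)[OF p X Yp]
    by (simp add: nabla_def inner_tproj_tangent rmul_tangent H_def)
qed

lemma smooth_tproj: "smooth_S3 (\<lambda>q. tproj q v)"
  unfolding tproj_def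
  by (intro smooth_S3_diff smooth_S3_const smooth_S3_scaleR smooth_S3_inner smooth_S3_linear linear_ident)

lemma smooth_vfield_ext: "smooth_vfield (ext v)"
  using smooth_tproj tproj_tangent by (simp add: smooth_vfield_def ext_def)

text \<open>The derivative of an extended vector is normal, so extended vectors have vanishing Levi-Civita
  derivative at the base point. Hence in covariant derivatives of tensors, evaluated through such
  extensions, only the first term remains.\<close>

lemma D_S_tproj:
  assumes "p \<in> S3" "y \<in> tangent p" "v \<in> tangent p"
  shows "D_S (\<lambda>q. tproj q y) p v = - (y \<bullet> v) *\<^sub>R p"
proof -
  have "((\<lambda>q. tproj q y) has_derivative (\<lambda>h. 0 - ((y \<bullet> p) *\<^sub>R h + (y \<bullet> h) *\<^sub>R p))) (at p within S3)"
    unfolding tproj_def by (auto intro!: derivative_eq_intros)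
  then show ?thesis using D_S_eq[OF _ assms(1,3)] assms(2) by (simp add: tangent_def)
qed

lemma nabla_ext:
  assumes "p \<in> S3" "y \<in> tangent p" "v \<in> tangent p"
  shows "nabla (ext v) (ext y) p = 0"
proof -
  have "nabla (ext v) (ext y) p = tproj p (- (y \<bullet> v) *\<^sub>R p)"
    unfolding nabla_def ext_def tproj_id[OF assms(3)] D_S_tproj[OF assms] ..
  then show ?thesis by (simp add: tproj_def S3_inner[OF assms(1)])
qed

lemma nabla_plus_ext:
  assumes "p \<in> S3"
  shows "nabla_plus (ext x) (ext y) p \<bullet> lmul a p = y \<bullet> lmul a (tproj p x)"
proof -
  have t: "ext x p \<in> tangent p" using assms by (simp add: ext_def tproj_tangent)
  have "nabla_plus (ext x) (ext y) p \<bullet> lmul a p = D_S (\<lambda>q. ext y q \<bullet> lmul a q) p (ext x p)"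
    by (rule nabla_plus_lmul[where X="ext x", OF assms t smooth_vfield_ext])
  also have "\<dots> = D_S (\<lambda>q. y \<bullet> lmul a q) p (ext x p)"
    by (simp add: ext_def inner_tproj_tangent lmul_tangent)
  also have "\<dots> = y \<bullet> lmul a (ext x p)"
    by (intro D_S_linear linear_inner_right linear_lmul assms t)
  finally show ?thesis by (simp add: ext_def)
qed

lemma nabla_minus_ext:
  assumes "p \<in> S3"
  shows "nabla_minus (ext x) (ext y) p \<bullet> rmul a p = y \<bullet> rmul a (tproj p x)"
proof -
  have t: "ext x p \<in> tangent p" using assms by (simp add: ext_def tproj_tangent)
  have "nabla_minus (ext x) (ext y) p \<bullet> rmul a p = D_S (\<lambda>q. ext y q \<bullet> rmul a q) p (ext x p)"
    by (rule nabla_minus_rmul[where X="ext x", OF assms t smooth_vfield_ext])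
  also have "\<dots> = D_S (\<lambda>q. y \<bullet> rmul a q) p (ext x p)"
    by (simp add: ext_def inner_tproj_tangent rmul_tangent)
  also have "\<dots> = y \<bullet> rmul a (ext x p)"
    by (intro D_S_linear linear_inner_right linear_rmul assms t)
  finally show ?thesis by (simp add: ext_def)
qed

lemma smooth_vfield_nabla_plus_ext: "smooth_vfield (nabla_plus (ext x) (ext y))"
proof -
  have "smooth_S3 (\<lambda>p. \<Sum>i\<in>UNIV. (y \<bullet> lmul (axis i 1) (tproj p x)) *\<^sub>R lframe p i)"
    unfolding tproj_def linear_diff[OF linear_lmul] linear_scale[OF linear_lmul]
    by (intro smooth_S3_sum smooth_S3_diff smooth_S3_const smooth_S3_scaleR smooth_S3_inner
        smooth_S3_linear[OF linear_ident] smooth_S3_linear[OF linear_lmul] smooth_S3_linear[OF linear_lframe])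
  then have "smooth_S3 (nabla_plus (ext x) (ext y))"
  proof (rule smooth_S3_cong)
    fix p assume p: "p \<in> S3"
    then show "(\<Sum>i\<in>UNIV. (y \<bullet> lmul (axis i 1) (tproj p x)) *\<^sub>R lframe p i) = nabla_plus (ext x) (ext y) p"
      using linear_tangent_frame[OF tangent_frame_lframe[OF p] bismut_props(1)[OF p] linear_ident,
          of 1 "ext x" "ext y"]
      by (simp add: lframe_def nabla_plus_ext[OF p])
  qed
  then show ?thesis by (simp add: smooth_vfield_def bismut_props)
qed

text \<open>In the parallel frame of the fields \<open>lmul a\<close>, \<open>nabla_plus\<close> is the differentiation of coefficient functions, and
  for \<open>ext z\<close> these are linear in the point. Their second derivatives at \<open>p\<close> along \<open>ext x\<close> and \<open>ext y\<close>
  are symmetric in \<open>x\<close> and \<open>y\<close>, and the bracket of \<open>ext x\<close> and \<open>ext y\<close> vanishes at \<open>p\<close>.\<close>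

lemma Rm_plus_zero:
  assumes p: "p \<in> S3" and x: "x \<in> tangent p" and y: "y \<in> tangent p"
  shows "Rm_plus p x y z w = 0"
proof -
  have e: "ext x p = x" "ext y p = y" using x y by (simp_all add: ext_def tproj_id)
  have b: "lie_bracket (ext x) (ext y) p = 0"
    using D_S_tproj[OF p x y] D_S_tproj[OF p y x] x y
    by (simp add: lie_bracket_def ext_def tproj_id inner_commute)
  have nn: "nabla_plus (ext x') (nabla_plus (ext y') (ext z)) p \<bullet> lmul a p = - (y' \<bullet> x') * (z \<bullet> lmul a p)"
    if x': "x' \<in> tangent p" and y': "y' \<in> tangent p" for x' y' a
  proof -
    have e': "ext x' p = x'" using x' by (simp add: ext_def tproj_id)
    have l: "linear (\<lambda>v. z \<bullet> lmul a v)"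
      by (rule linear_inner_right[OF linear_lmul])
    have "nabla_plus (ext x') (nabla_plus (ext y') (ext z)) p \<bullet> lmul a p
        = D_S (\<lambda>q. nabla_plus (ext y') (ext z) q \<bullet> lmul a q) p x'"
      using nabla_plus_lmul[where X="ext x'", OF p _ smooth_vfield_nabla_plus_ext] x' by (simp add: e')
    also have "\<dots> = D_S (\<lambda>q. z \<bullet> lmul a (tproj q y')) p x'"
      by (rule fun_cong[OF D_S_cong[OF _ p]]) (rule nabla_plus_ext)
    also have "\<dots> = z \<bullet> lmul a (D_S (\<lambda>q. tproj q y') p x')"
      using l by (intro D_S_eq[OF _ p x'] bounded_linear.has_derivative[of "\<lambda>v. z \<bullet> lmul a v"]
          smooth_S3_has_derivative[OF smooth_tproj p]) (simp add: linear_conv_bounded_linear)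
    also have "\<dots> = - (y' \<bullet> x') * (z \<bullet> lmul a p)"
      by (simp add: D_S_tproj[OF p y' x'] linear_neg[OF linear_lmul] linear_scale[OF linear_lmul])
    finally show ?thesis .
  qed
  let ?w = "nabla_plus (ext x) (nabla_plus (ext y) (ext z)) p - nabla_plus (ext y) (nabla_plus (ext x) (ext z)) p
         - nabla_plus (lie_bracket (ext x) (ext y)) (ext z) p"
  have "nabla_plus (lie_bracket (ext x) (ext y)) (ext z) p \<bullet> lmul a p = 0" for a
  proof -
    have "smooth_S3 (\<lambda>q. ext z q \<bullet> lmul a q)"
      using smooth_vfield_ext[of z]
      by (intro smooth_S3_inner smooth_S3_linear[OF linear_lmul]) (simp add: smooth_vfield_def)
    then have "D_S (\<lambda>q. ext z q \<bullet> lmul a q) p 0 = 0" by (rule linear_0[OF D_S_linear_on[OF _ p]])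
    then show ?thesis
      using nabla_plus_lmul[where X="lie_bracket (ext x) (ext y)", OF p _ smooth_vfield_ext] b
      by (simp add: subspace_0[OF subspace_tangent])
  qed
  then have "?w \<bullet> lframe p i = 0" for i
    using nn[OF x y] nn[OF y x] by (simp add: lframe_def inner_diff_left inner_commute[of x y])
  moreover have "?w \<in> tangent p"
    by (intro subspace_diff[OF subspace_tangent] bismut_props(1) p)
  ultimately have "?w = 0"
    using linear_tangent_frame[OF tangent_frame_lframe[OF p] _ linear_ident, of ?w] by simp
  then show ?thesis by (simp add: Rm_plus_def Let_def)
qed

lemma ring_Rm_plus_zero:
  assumes "p \<in> S3" "y \<in> tangent p"
  shows "ring_Rm_plus \<gamma> p y z = 0"
  unfolding ring_Rm_plus_def
  by (intro sum.neutral ballI) (use onb_props(1)[of p] Rm_plus_zero[OF assms(1) _ assms(2)] in auto)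

section \<open>Integration over the sphere\<close>

lemma sgn_in_S3: "x \<noteq> 0 \<Longrightarrow> sgn x \<in> S3" for x :: "real^4"
  by (simp add: norm_sgn)

lemma measurable_sgn_S3 [measurable]:
  fixes f :: "real^4 \<Rightarrow> real"
  assumes "continuous_on S3 f"
  shows "(\<lambda>x. f (sgn x)) \<in> borel_measurable borel"
proof (rule borel_measurable_continuous_countable_exceptions[of "{0}"])
  have "continuous_on (- {0::real^4}) sgn"
    by (intro continuous_on_sgn continuous_on_id) auto
  then show "continuous_on (- {0}) (\<lambda>x. f (sgn x))"
    by (rule continuous_on_compose2[OF assms]) (auto simp: norm_sgn split: if_splits)
qed simp

lemma bounded_on_S3:
  fixes f :: "real^4 \<Rightarrow> real"
  assumes "continuous_on S3 f"
  obtains K where "\<And>p. p \<in> S3 \<Longrightarrow> \<bar>f p\<bar> \<le> K" "0 \<le> K"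
proof -
  have "bounded (f ` S3)"
    by (intro compact_imp_bounded compact_continuous_image assms compact_sphere)
  then obtain K where "\<forall>y\<in>f ` S3. norm y \<le> K" using bounded_iff by blast
  then show thesis by (intro that[of "max K 0"]) (auto simp: le_max_iff_disj)
qed

lemma integrable_S3:
  fixes f :: "real^4 \<Rightarrow> real"
  assumes "continuous_on S3 f"
  shows "integrable lborel (\<lambda>x. indicator (ball 0 1) x *\<^sub>R f (sgn x))"
proof -
  obtain K where K: "\<And>p. p \<in> S3 \<Longrightarrow> \<bar>f p\<bar> \<le> K" "0 \<le> K" using bounded_on_S3[OF assms] by blast
  have "emeasure lborel (ball (0::real^4) 1) < \<infinity>" by (rule emeasure_bounded_finite) auto
  moreover have "AE x in lborel. x \<in> ball 0 1 \<longrightarrow> norm (indicator (ball 0 1) x *\<^sub>R f (sgn x)) \<le> K"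
    using AE_lborel_singleton[of "0::real^4"]
    by eventually_elim (use K sgn_in_S3 in \<open>auto simp: indicator_def\<close>)
  ultimately show ?thesis
    using measurable_sgn_S3[OF assms]
    by (intro integrableI_bounded_set[of "ball 0 1"]) (auto simp: indicator_def)
qed

text \<open>At the origin \<open>sgn\<close> leaves the sphere, where an integrand may take any value; the origin is a null set.\<close>

lemma integral_S3_cong:
  assumes "continuous_on S3 f" "\<And>p. p \<in> S3 \<Longrightarrow> f p = g p"
  shows "integral_S3 g = integral_S3 f"
proof -
  have g: "continuous_on S3 g" using assms continuous_on_eq by blast
  have "AE x in lborel. indicator (ball 0 1) x *\<^sub>R g (sgn x) = indicator (ball 0 1) x *\<^sub>R f (sgn x)"
    using AE_lborel_singleton[of "0::real^4"]
    by eventually_elim (use assms(2)[OF sgn_in_S3] in auto)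
  then have "(LINT x|lborel. indicator (ball 0 1) x *\<^sub>R g (sgn x)) = (LINT x|lborel. indicator (ball 0 1) x *\<^sub>R f (sgn x))"
    using integrable_S3[OF assms(1)] integrable_S3[OF g]
    by (intro integral_cong_AE) (auto dest: borel_measurable_integrable)
  then show ?thesis by (simp add: integral_S3_def set_lebesgue_integral_def)
qed

lemma integral_S3_add:
  assumes "continuous_on S3 f" "continuous_on S3 g"
  shows "integral_S3 (\<lambda>p. f p + g p) = integral_S3 f + integral_S3 g"
  using Bochner_Integration.integral_add[OF assms[THEN integrable_S3]]
  by (simp add: integral_S3_def set_lebesgue_integral_def distrib_left)

lemma integral_S3_cmult: "integral_S3 (\<lambda>p. c * f p) = c * integral_S3 f"
  by (simp add: integral_S3_def set_lebesgue_integral_def mult.left_commute)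

lemma integral_S3_sum:
  assumes "\<And>i. i \<in> I \<Longrightarrow> continuous_on S3 (f i)"
  shows "integral_S3 (\<lambda>p. \<Sum>i\<in>I. f i p) = (\<Sum>i\<in>I. integral_S3 (f i))"
  using assms
proof (induction I rule: infinite_finite_induct)
  case (insert i I)
  then show ?case by (simp add: integral_S3_add continuous_on_sum)
qed (simp_all add: integral_S3_def)

text \<open>If \<open>f p\<close> were nonzero, \<open>f (sgn x)\<close> would be nonzero on an open set around \<open>p / 2\<close>, which is not
  negligible.\<close>

lemma integral_S3_eq_0_imp:
  assumes f: "continuous_on S3 f" and nn: "\<And>p. p \<in> S3 \<Longrightarrow> 0 \<le> f p"
    and int: "integral_S3 f = 0" and p: "p \<in> S3"
  shows "f p = 0"
proof (rule ccontr)
  assume "f p \<noteq> 0"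
  define S where "S = {x \<in> ball 0 1 - {0}. f (sgn x) \<noteq> 0}"
  have "AE x in lborel. 0 \<le> indicator (ball 0 1) x *\<^sub>R f (sgn x)"
    using AE_lborel_singleton[of "0::real^4"]
    by eventually_elim (use nn[OF sgn_in_S3] in \<open>auto simp: indicator_def\<close>)
  then have "AE x in lborel. indicator (ball 0 1) x *\<^sub>R f (sgn x) = 0"
    using int integral_nonneg_eq_0_iff_AE[OF integrable_S3[OF f]]
    by (simp add: integral_S3_def set_lebesgue_integral_def)
  then obtain N where N: "N \<in> null_sets lborel" "{x. indicator (ball 0 1) x *\<^sub>R f (sgn x) \<noteq> 0} \<subseteq> N"
    by (auto simp: eventually_ae_filter)
  have "negligible N" using N(1) null_sets_completionI by (simp add: negligible_iff_null_sets)
  moreover have "S \<subseteq> N" using N(2) by (auto simp: S_def)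
  ultimately have "negligible S" by (rule negligible_subset)
  moreover have "open S"
  proof -
    have "continuous_on (ball 0 1 - {0::real^4}) sgn"
      by (intro continuous_on_sgn continuous_on_id) auto
    then have "continuous_on (ball 0 1 - {0}) (\<lambda>x. f (sgn x))"
      by (rule continuous_on_compose2[OF f]) (auto simp: norm_sgn split: if_splits)
    then have "open ((\<lambda>x. f (sgn x)) -` (- {0}) \<inter> (ball 0 1 - {0}))"
      by (rule continuous_on_open_vimage[THEN iffD1, rule_format, rotated]) (auto intro: open_delete)
    then show ?thesis by (simp add: S_def vimage_def Int_def conj_commute)
  qed
  moreover have "(1/2) *\<^sub>R p \<in> S"
    using p \<open>f p \<noteq> 0\<close> by (auto simp: S_def sgn_scaleR sgn_div_norm)
  ultimately show False using open_not_negligible by blast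
qed

lemma distr_lborel_orthogonal:
  fixes R :: "real^4 \<Rightarrow> real^4"
  assumes R: "orthogonal_transformation R"
  shows "distr lborel borel R = lborel"
proof (rule lborel_eqI[symmetric])
  have [measurable]: "R \<in> borel_measurable borel"
    using R by (intro borel_measurable_continuous_onI linear_continuous_on)
      (simp add: orthogonal_transformation_linear linear_linear)
  fix l u :: "real^4" assume le: "\<And>b. b \<in> Basis \<Longrightarrow> l \<bullet> b \<le> u \<bullet> b"
  have box: "box l u \<in> lmeasurable" "emeasure lborel (box l u) < \<infinity>"
    by (auto simp: emeasure_lborel_box_eq)
  have oi: "orthogonal_transformation (inv R)" using R by (rule orthogonal_transformation_inv)
  have vim: "R -` box l u = inv R ` box l u"
    using orthogonal_transformation_bij[OF R] by (simp add: bij_vimage_eq_inv_image)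
  have "emeasure lborel (R -` box l u) = emeasure lebesgue (R -` box l u)"
    using measurable_sets_borel[of R borel "box l u"] by (simp add: main_part_sets)
  also have "\<dots> = ennreal (measure lebesgue (inv R ` box l u))"
    unfolding vim using measurable_orthogonal_image[OF oi box(1)] by (simp add: emeasure_eq_measure2)
  also have "\<dots> = emeasure lborel (box l u)"
    using measure_orthogonal_image[OF oi box(1)] box by (simp add: emeasure_eq_measure2)
  finally show "emeasure (distr lborel borel R) (box l u) = (\<Prod>b\<in>Basis. (u - l) \<bullet> b)"
    using le by (simp add: emeasure_distr emeasure_lborel_box)
qed simp

lemma integral_S3_orthogonal:
  assumes R: "orthogonal_transformation R" and f: "continuous_on S3 f"
  shows "integral_S3 (\<lambda>p. f (R p)) = integral_S3 f"
proof -
  have n: "norm (R x) = norm x" for x using R by (simp add: orthogonal_transformation)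
  have s: "R (sgn x) = sgn (R x)" for x
    using orthogonal_transformation_linear[OF R] by (simp add: sgn_div_norm n linear_scale)
  have [measurable]: "R \<in> borel_measurable borel"
    using R by (intro borel_measurable_continuous_onI linear_continuous_on)
      (simp add: orthogonal_transformation_linear linear_linear)
  have "(LINT x|lborel. indicator (ball 0 1) x *\<^sub>R f (sgn x))
      = (LINT x|distr lborel borel R. indicator (ball 0 1) x *\<^sub>R f (sgn x))"
    by (simp add: distr_lborel_orthogonal[OF R])
  also have "\<dots> = (LINT x|lborel. indicator (ball 0 1) (R x) *\<^sub>R f (sgn (R x)))"
    using borel_measurable_integrable[OF integrable_S3[OF f]] by (intro integral_distr) auto
  also have "\<dots> = (LINT x|lborel. indicator (ball 0 1) x *\<^sub>R f (R (sgn x)))"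
    by (simp add: s indicator_def n)
  finally show ?thesis by (simp add: integral_S3_def set_lebesgue_integral_def)
qed

text \<open>The divergence theorem for the Killing field \<open>M\<close>. Its flow \<open>cos t *\<^sub>R p + sin t *\<^sub>R M p\<close> consists of
  rotations, which preserve the integral of \<open>f\<close>; the difference quotients of \<open>f\<close> along the flow
  have integral \<open>0\<close>, and they converge to the derivative, boundedly by the mean value theorem.\<close>

lemma integral_S3_D_S:
  fixes f :: "real^4 \<Rightarrow> real"
  assumes f: "smooth_S3 f" and M: "linear M" "\<And>p. M p \<bullet> p = 0" "\<And>p. norm (M p) = norm p" "\<And>p. M (M p) = - p"
  shows "integral_S3 (\<lambda>p. D_S f p (M p)) = 0"
proof -
  define R where "R = (\<lambda>t p. cos t *\<^sub>R p + sin t *\<^sub>R M p)"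
  have MM: "M p \<bullet> M p = p \<bullet> p" for p using M(3)[of p] by (simp add: dot_square_norm)
  have Rlin: "linear (R t)" for t
    unfolding R_def by (intro linear_compose_add linear_compose_scale_right linear_ident M(1))
  have Rn: "norm (R t p) = norm p" for t p
  proof -
    have "R t p \<bullet> R t p = (cos t)\<^sup>2 * (p \<bullet> p) + (sin t)\<^sup>2 * (p \<bullet> p)"
      by (simp add: R_def inner_add_left inner_add_right M(2) inner_commute[of p "M p"] MM power2_eq_square)
    also have "\<dots> = p \<bullet> p" by (simp flip: distrib_right)
    finally have "R t p \<bullet> R t p = p \<bullet> p" .
    then show ?thesis by (simp add: norm_eq_sqrt_inner)
  qed
  have Ro: "orthogonal_transformation (R t)" for t
    using Rlin Rn by (simp add: orthogonal_transformation)
  have RS: "R t p \<in> S3" if "p \<in> S3" for t p using that by (simp add: Rn)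
  have MR: "M (R t p) = - sin t *\<^sub>R p + cos t *\<^sub>R M p" for t p
    using M(1) by (simp add: R_def linear_add linear_scale M(4))
  define g where "g = (\<lambda>p. D_S f p (M p))"
  have "smooth_S3 g" unfolding g_def by (rule smooth_S3_D_S[OF f M(1)]) (simp add: tangent_def M(2))
  then have gc: "continuous_on S3 g" by (rule smooth_S3_continuous_on)
  have fc: "continuous_on S3 f" using f by (rule smooth_S3_continuous_on)
  obtain K where K: "\<And>p. p \<in> S3 \<Longrightarrow> \<bar>g p\<bar> \<le> K" "0 \<le> K" using bounded_on_S3[OF gc] by blast
  have der: "((\<lambda>t. f (R t p)) has_real_derivative g (R t p)) (at t)" if p: "p \<in> S3" for p t
  proof -
    have "M p \<in> tangent p" "norm (M p) = 1" using M(2,3) p by (simp_all add: tangent_def)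
    from DERIV_great_circle[OF f p this, of t] show ?thesis
      unfolding g_def MR unfolding R_def .
  qed
  have R0: "R 0 p = p" for p by (simp add: R_def)
  \<comment> \<open>the difference quotient for the time step \<open>1 / (n + 1)\<close>\<close>
  define s where "s = (\<lambda>(n::nat) p. (f (R (1 / Suc n) p) - f p) * Suc n)"
  have fRc: "continuous_on S3 (\<lambda>p. f (R t p))" for t
    by (rule continuous_on_compose2[OF fc linear_continuous_on]) (use Rlin RS in \<open>auto simp: linear_linear\<close>)
  have sc: "continuous_on S3 (s n)" for n unfolding s_def by (intro continuous_intros fRc fc)
  have s0: "integral_S3 (s n) = 0" for n
  proof -
    have "integral_S3 (s n) = integral_S3 (\<lambda>p. Suc n * f (R (1 / Suc n) p) + (- Suc n) * f p)"
      by (rule arg_cong[of _ _ integral_S3]) (simp add: s_def fun_eq_iff algebra_simps)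
    also have "\<dots> = Suc n * integral_S3 (\<lambda>p. f (R (1 / Suc n) p)) + (- Suc n) * integral_S3 f"
      by (subst integral_S3_add) (auto intro!: continuous_intros fRc fc simp only: integral_S3_cmult)
    finally show ?thesis by (simp add: integral_S3_orthogonal[OF Ro fc] algebra_simps)
  qed
  have lim: "(\<lambda>n. s n p) \<longlonglongrightarrow> g p" if p: "p \<in> S3" for p
  proof -
    have "((\<lambda>h. (f (R h p) - f p) / h) \<longlongrightarrow> g p) (at 0)"
      using der[OF p, of 0] by (simp add: has_field_derivative_iff R0)
    moreover have "filterlim (\<lambda>n. 1 / real (Suc n)) (at 0) sequentially"
      using LIMSEQ_inverse_real_of_nat by (intro filterlim_atI) (simp_all add: inverse_eq_divide)
    ultimately have "(\<lambda>n. (f (R (1 / Suc n) p) - f p) / (1 / Suc n)) \<longlonglongrightarrow> g p"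
      by (rule filterlim_compose)
    then show ?thesis by (simp add: s_def)
  qed
  have bnd: "\<bar>s n p\<bar> \<le> K" if p: "p \<in> S3" for n p
  proof -
    obtain z where z: "f (R (1 / Suc n) p) - f (R 0 p) = (1 / Suc n - 0) * g (R z p)"
      using MVT2[of 0 "1 / Suc n" "\<lambda>t. f (R t p)" "\<lambda>t. g (R t p)"] der[OF p] by auto
    then have "s n p = g (R z p)" by (simp add: s_def R0)
    then show ?thesis using K(1)[OF RS[OF p]] by simp
  qed
  have "(\<lambda>n. LINT x|lborel. indicator (ball 0 1) x *\<^sub>R s n (sgn x))
      \<longlonglongrightarrow> (LINT x|lborel. indicator (ball 0 1) x *\<^sub>R g (sgn x))"
  proof (rule integral_dominated_convergence[where w="\<lambda>x. indicator (ball 0 1) x *\<^sub>R K"])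
    show "integrable lborel (\<lambda>x. indicator (ball (0::real^4) 1) x *\<^sub>R K)"
      using integrable_S3[of "\<lambda>_. K"] by simp
    show "AE x in lborel. (\<lambda>n. indicator (ball 0 1) x *\<^sub>R s n (sgn x)) \<longlonglongrightarrow> indicator (ball 0 1) x *\<^sub>R g (sgn x)"
      using AE_lborel_singleton[of "0::real^4"]
      by eventually_elim (auto intro!: tendsto_intros lim sgn_in_S3)
    show "AE x in lborel. norm (indicator (ball 0 1) x *\<^sub>R s n (sgn x)) \<le> indicator (ball 0 1) x *\<^sub>R K" for n
      using AE_lborel_singleton[of "0::real^4"]
      by eventually_elim (use bnd sgn_in_S3 in \<open>auto simp: indicator_def\<close>)
  qed (use integrable_S3[OF gc] integrable_S3[OF sc] in \<open>auto dest: borel_measurable_integrable\<close>)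
  moreover have "(LINT x|lborel. indicator (ball 0 1) x *\<^sub>R s n (sgn x)) = 0" for n
    using s0[of n] by (simp add: integral_S3_def set_lebesgue_integral_def)
  ultimately have "(LINT x|lborel. indicator (ball 0 1) x *\<^sub>R g (sgn x)) = 0"
    using LIMSEQ_unique[OF _ tendsto_const] by fastforce
  then show ?thesis by (simp add: integral_S3_def set_lebesgue_integral_def g_def)
qed

section \<open>Tensors in the parallel frames\<close>

text \<open>The mixed connection acts by \<open>nabla_minus\<close> on the first slot and by \<open>nabla_plus\<close> on the second, so the
  frame of right products belongs to the first slot and that of left products to the second.\<close>

definition frame_coeff :: "tensor2 \<Rightarrow> 3 \<Rightarrow> 3 \<Rightarrow> real^4 \<Rightarrow> real" where
  "frame_coeff \<gamma> a b p = \<gamma> p (rframe p a) (lframe p b)"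

definition frame_tensor :: "(3 \<Rightarrow> 3 \<Rightarrow> real^4 \<Rightarrow> real) \<Rightarrow> tensor2" where
  "frame_tensor c p y z =
     (if p \<in> S3 then \<Sum>a\<in>UNIV. \<Sum>b\<in>UNIV. c a b p * (y \<bullet> rframe p a) * (z \<bullet> lframe p b) else 0)"

lemma linear_mult_right: "linear f \<Longrightarrow> linear (\<lambda>x. f x * c)" for c :: real
  by (auto intro!: linearI simp: linear_add linear_scale algebra_simps)

lemma linear_mult_left: "linear f \<Longrightarrow> linear (\<lambda>x. c * f x)" for c :: real
  by (auto intro!: linearI simp: linear_add linear_scale algebra_simps)

lemma linear_sum_fun: "(\<And>i. i \<in> I \<Longrightarrow> linear (f i)) \<Longrightarrow> linear (\<lambda>x. \<Sum>i\<in>I. f i x)"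
  by (rule linear_compose_sum) simp

lemma linear_inner_left: "linear (\<lambda>x. x \<bullet> y)"
  by (auto intro!: linearI simp: inner_add_left)

lemma frame_orthonormal:
  assumes "p \<in> S3"
  shows "lframe p i \<bullet> lframe p j = of_bool (i = j)" "rframe p i \<bullet> rframe p j = of_bool (i = j)"
  using tangent_frame_lframe[OF assms] tangent_frame_rframe[OF assms] by (auto simp: tangent_frame_def)

lemma frame_normal: "p \<bullet> lframe p i = 0" "p \<bullet> rframe p i = 0"
  using lframe_tangent[of p i] rframe_tangent[of p i] by (simp_all add: tangent_def inner_commute)

lemma sum_of_bool2:
  fixes c :: "3 \<Rightarrow> 3 \<Rightarrow> real"
  shows "(\<Sum>a\<in>UNIV. \<Sum>b\<in>UNIV. c a b * of_bool (i = a) * of_bool (j = b)) = c i j"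
proof -
  have "(\<Sum>b\<in>UNIV. c a b * of_bool (i = a) * of_bool (j = b)) = c a j * of_bool (i = a)" for a
    by (simp add: of_bool_def if_distrib[of "\<lambda>x. _ * x"] cong: if_cong)
  then show ?thesis
    by (simp add: of_bool_def if_distrib[of "\<lambda>x. _ * x"] cong: if_cong)
qed

lemma smooth_frames: "smooth_S3 (\<lambda>p. lframe p i)" "smooth_S3 (\<lambda>p. rframe p i)"
  by (rule smooth_S3_linear linear_lframe linear_rframe)+

lemma smooth_tensor2_frame_tensor:
  assumes "\<And>a b. smooth_S3 (c a b)"
  shows "smooth_tensor2 (frame_tensor c)"
  unfolding smooth_tensor2_def
proof (intro conjI allI ballI impI)
  fix p
  show "bilinear (frame_tensor c p)"
    unfolding bilinear_def frame_tensor_def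
    by (cases "p \<in> S3")
      (auto intro!: linear_sum_fun linear_mult_right linear_mult_left linear_inner_left linear_zero)
  show "frame_tensor c p p v = 0" "frame_tensor c p v p = 0" for v
    by (simp_all add: frame_tensor_def frame_normal)
  show "p \<notin> S3 \<Longrightarrow> frame_tensor c p v w = 0" for v w
    unfolding frame_tensor_def by simp
next
  fix X Y assume "smooth_vfield X" "smooth_vfield Y"
  then have "smooth_S3 (\<lambda>p. \<Sum>a\<in>UNIV. \<Sum>b\<in>UNIV. c a b p * (X p \<bullet> rframe p a) * (Y p \<bullet> lframe p b))"
    by (intro smooth_S3_sum smooth_S3_mult smooth_S3_inner smooth_frames assms) (simp_all add: smooth_vfield_def)
  then show "smooth_S3 (\<lambda>p. frame_tensor c p (X p) (Y p))"
    by (rule smooth_S3_cong) (simp add: frame_tensor_def)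
qed

lemma frame_coeff_frame_tensor: "p \<in> S3 \<Longrightarrow> frame_coeff (frame_tensor c) a b p = c a b p"
  by (simp only: frame_coeff_def frame_tensor_def if_True frame_orthonormal sum_of_bool2)

lemma frame_tensor_cong:
  assumes "\<And>a b p. p \<in> S3 \<Longrightarrow> c a b p = d a b p"
  shows "frame_tensor c = frame_tensor d"
  using assms by (simp add: frame_tensor_def fun_eq_iff)

text \<open>The conventions on the values in the normal direction and off the sphere make a tensor, as a
  function, determined by its coefficients on the sphere.\<close>

lemma smooth_tensor2_eq_frame_tensor:
  assumes "smooth_tensor2 \<gamma>"
  shows "frame_tensor (frame_coeff \<gamma>) = \<gamma>"
proof (intro ext)
  fix p y z
  show "frame_tensor (frame_coeff \<gamma>) p y z = \<gamma> p y z"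
  proof (cases "p \<in> S3")
    case True
    have bl: "linear (\<lambda>y. \<gamma> p y z)" "linear (\<gamma> p y)" for y z
      using assms by (simp_all add: smooth_tensor2_def bilinear_def)
    have n: "\<gamma> p p v = 0" "\<gamma> p v p = 0" for v
      using assms True unfolding smooth_tensor2_def by blast+
    have "\<gamma> p y z = \<gamma> p ((y \<bullet> p) *\<^sub>R p + (\<Sum>a\<in>UNIV. (y \<bullet> rframe p a) *\<^sub>R rframe p a)) z"
      using vec_expand_rframe[OF True, of y] by simp
    also have "\<dots> = (\<Sum>a\<in>UNIV. (y \<bullet> rframe p a) * \<gamma> p (rframe p a) z)"
      by (simp add: linear_add[OF bl(1)] linear_sum[OF bl(1)] linear_scale[OF bl(1)] n)
    also have "\<dots> = (\<Sum>a\<in>UNIV. (y \<bullet> rframe p a) *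
        \<gamma> p (rframe p a) ((z \<bullet> p) *\<^sub>R p + (\<Sum>b\<in>UNIV. (z \<bullet> lframe p b) *\<^sub>R lframe p b)))"
      using vec_expand_lframe[OF True, of z] by simp
    also have "\<dots> = frame_tensor (frame_coeff \<gamma>) p y z"
      using True by (simp add: linear_add[OF bl(2)] linear_sum[OF bl(2)] linear_scale[OF bl(2)] n
          frame_tensor_def frame_coeff_def sum_distrib_left mult_ac)
    finally show ?thesis by simp
  next
    case False
    then have "frame_tensor (frame_coeff \<gamma>) p y z = 0" unfolding frame_tensor_def by simp
    moreover have "\<gamma> p y z = 0" using assms False unfolding smooth_tensor2_def by blast
    ultimately show ?thesis by simp
  qed
qed

lemma smooth_frame_coeff:
  assumes "smooth_tensor2 \<gamma>" shows "smooth_S3 (frame_coeff \<gamma> a b)"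
proof -
  have "smooth_vfield (\<lambda>p. rframe p a)" "smooth_vfield (\<lambda>p. lframe p b)"
    by (simp_all add: smooth_vfield_def smooth_frames lframe_tangent rframe_tangent)
  then show ?thesis using assms unfolding smooth_tensor2_def frame_coeff_def[abs_def] by blast
qed

lemma smooth_tensor2_expand:
  assumes "smooth_tensor2 \<gamma>" "p \<in> S3"
  shows "\<gamma> p y z = (\<Sum>a\<in>UNIV. \<Sum>b\<in>UNIV. frame_coeff \<gamma> a b p * (y \<bullet> rframe p a) * (z \<bullet> lframe p b))"
  using smooth_tensor2_eq_frame_tensor[OF assms(1), THEN fun_cong, THEN fun_cong, THEN fun_cong, of p y z] assms(2)
  by (simp add: frame_tensor_def)

text \<open>Both frames being parallel, the mixed connection differentiates the coefficient functions.\<close>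

lemma nabla_bar_eq:
  assumes g: "smooth_tensor2 \<gamma>" and p: "p \<in> S3" and v: "v \<in> tangent p" and y: "y \<in> tangent p" and z: "z \<in> tangent p"
  shows "nabla_bar \<gamma> p v y z =
    (\<Sum>a\<in>UNIV. \<Sum>b\<in>UNIV. D_S (frame_coeff \<gamma> a b) p v * (y \<bullet> rframe p a) * (z \<bullet> lframe p b))"
proof -
  let ?Y = "ext y" and ?Z = "ext z" and ?V = "ext v"
  have e: "?Y p = y" "?Z p = z" "?V p = v" using y z v by (simp_all add: ext_def tproj_id)
  have sy: "smooth_S3 (\<lambda>q. y \<bullet> rframe q a)" "smooth_S3 (\<lambda>q. z \<bullet> lframe q a)" for a
    by (intro smooth_S3_inner smooth_S3_const smooth_frames)+
  note sc = smooth_frame_coeff[OF g]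
  have "D_S (\<lambda>q. \<gamma> q (?Y q) (?Z q)) p
      = D_S (\<lambda>q. \<Sum>a\<in>UNIV. \<Sum>b\<in>UNIV. frame_coeff \<gamma> a b q * (y \<bullet> rframe q a) * (z \<bullet> lframe q b)) p"
    by (rule D_S_cong[OF _ p])
      (simp add: smooth_tensor2_expand[OF g] ext_def inner_tproj_tangent lframe_tangent rframe_tangent)
  then have "D_S (\<lambda>q. \<gamma> q (?Y q) (?Z q)) p v
      = (\<Sum>a\<in>UNIV. \<Sum>b\<in>UNIV. D_S (\<lambda>q. frame_coeff \<gamma> a b q * (y \<bullet> rframe q a) * (z \<bullet> lframe q b)) p v)"
    using p v by (simp add: D_S_sum smooth_S3_sum smooth_S3_mult sc sy)
  also have "\<dots> = (\<Sum>a\<in>UNIV. \<Sum>b\<in>UNIV.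
      D_S (frame_coeff \<gamma> a b) p v * (y \<bullet> rframe p a) * (z \<bullet> lframe p b)
      + frame_coeff \<gamma> a b p * (y \<bullet> rframe v a) * (z \<bullet> lframe p b)
      + frame_coeff \<gamma> a b p * (y \<bullet> rframe p a) * (z \<bullet> lframe v b))"
    using p v by (simp add: D_S_mult smooth_S3_mult sc sy algebra_simps
        D_S_linear[OF linear_inner_right[OF linear_lframe]] D_S_linear[OF linear_inner_right[OF linear_rframe]])
  finally have 1: "D_S (\<lambda>q. \<gamma> q (?Y q) (?Z q)) p v = \<dots>" .
  have "nabla_minus ?V ?Y p \<bullet> rframe p a = y \<bullet> rframe v a" "nabla_plus ?V ?Z p \<bullet> lframe p a = z \<bullet> lframe v a" for a
    unfolding rframe_def lframe_def using nabla_minus_ext[OF p] nabla_plus_ext[OF p] tproj_id[OF v] by simp_all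
  then have 2: "\<gamma> p (nabla_minus ?V ?Y p) z = (\<Sum>a\<in>UNIV. \<Sum>b\<in>UNIV. frame_coeff \<gamma> a b p * (y \<bullet> rframe v a) * (z \<bullet> lframe p b))"
    "\<gamma> p y (nabla_plus ?V ?Z p) = (\<Sum>a\<in>UNIV. \<Sum>b\<in>UNIV. frame_coeff \<gamma> a b p * (y \<bullet> rframe p a) * (z \<bullet> lframe v b))"
    by (simp_all add: smooth_tensor2_expand[OF g p])
  show ?thesis
    unfolding nabla_bar_def Let_def e 1 2 by (simp add: sum.distrib)
qed

section \<open>The adjoint of the mixed connection\<close>

definition frame_deriv :: "3 \<Rightarrow> (real^4 \<Rightarrow> real) \<Rightarrow> real^4 \<Rightarrow> real" where
  "frame_deriv k f p = D_S f p (lframe p k)"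

lemma smooth_frame_deriv: "smooth_S3 f \<Longrightarrow> smooth_S3 (frame_deriv k f)"
  unfolding frame_deriv_def[abs_def] by (rule smooth_S3_D_S[OF _ linear_lframe lframe_tangent])

text \<open>Left multiplication by \<open>i\<close>, \<open>j\<close> or \<open>k\<close> is a complex structure compatible with the inner product, so
  the fields of the frame generate rotations.\<close>

lemma integral_frame_deriv:
  assumes "smooth_S3 f"
  shows "integral_S3 (frame_deriv k f) = 0"
proof -
  have "lframe (lframe p k) k = - p" for p
  proof -
    have "2 *\<^sub>R lframe (lframe p k) k = 2 *\<^sub>R (- p)"
      using lmul_clifford[of "axis k 1" "axis k 1" p] by (simp add: lframe_def inner_axis_axis flip: scaleR_2)
    then show ?thesis by (simp only: scaleR_cancel_left) simp
  qed
  moreover have "lframe p k \<bullet> p = 0" "norm (lframe p k) = norm p" for p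
    using frame_normal[of p k] by (simp_all add: inner_commute) (simp add: lframe_def norm_eq_sqrt_inner inner_lmul_lmul inner_axis_axis)
  ultimately show ?thesis
    unfolding frame_deriv_def[abs_def] by (intro integral_S3_D_S assms linear_lframe)
qed

lemma integral_by_parts:
  assumes "smooth_S3 f" "smooth_S3 g"
  shows "integral_S3 (\<lambda>p. frame_deriv k f p * frame_deriv k g p) = integral_S3 (\<lambda>p. - frame_deriv k (frame_deriv k f) p * g p)"
proof -
  note s = assms smooth_frame_deriv[OF assms(1), of k] smooth_frame_deriv[OF assms(2), of k]
    smooth_frame_deriv[OF smooth_frame_deriv[OF assms(1)], of k k]
  note c = s[THEN smooth_S3_continuous_on]
  have "0 = integral_S3 (frame_deriv k (\<lambda>p. frame_deriv k f p * g p))"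
    by (rule integral_frame_deriv[symmetric]) (intro smooth_S3_mult s)
  also have "\<dots> = integral_S3 (\<lambda>p. frame_deriv k f p * frame_deriv k g p + (-1) * (- frame_deriv k (frame_deriv k f) p * g p))"
    by (rule integral_S3_cong, intro continuous_intros c)
      (simp add: frame_deriv_def[of k "\<lambda>p. frame_deriv k f p * g p"] D_S_mult s lframe_tangent
        frame_deriv_def[of k "frame_deriv k f"] frame_deriv_def[of k g])
  also have "\<dots> = integral_S3 (\<lambda>p. frame_deriv k f p * frame_deriv k g p) + (-1) * integral_S3 (\<lambda>p. - frame_deriv k (frame_deriv k f) p * g p)"
    by (subst integral_S3_add) (auto intro!: continuous_intros c simp only: integral_S3_cmult)
  finally show ?thesis by simp
qed

lemma L2_inner2_eq:
  assumes b: "smooth_tensor2 \<beta>" and h: "smooth_tensor2 \<eta>"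
  shows "L2_inner2 \<beta> \<eta> = integral_S3 (\<lambda>p. \<Sum>a\<in>UNIV. \<Sum>b\<in>UNIV. frame_coeff \<beta> a b p * frame_coeff \<eta> a b p)"
  unfolding L2_inner2_def
proof (rule integral_S3_cong)
  show "continuous_on S3 (\<lambda>p. \<Sum>a\<in>UNIV. \<Sum>b\<in>UNIV. frame_coeff \<beta> a b p * frame_coeff \<eta> a b p)"
    by (intro continuous_intros smooth_frame_coeff[THEN smooth_S3_continuous_on] assms)
next
  fix p assume p: "p \<in> S3"
  have bl: "linear (\<lambda>y. \<beta> p y z)" "linear (\<beta> p y)" "linear (\<lambda>y. \<eta> p y z)" "linear (\<eta> p y)" for y z
    using b h by (simp_all add: smooth_tensor2_def bilinear_def)
  have "(\<Sum>i\<in>onb p. \<Sum>j\<in>onb p. \<beta> p i j * \<eta> p i j)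
      = (\<Sum>a\<in>UNIV. \<Sum>j\<in>onb p. \<beta> p (rframe p a) j * \<eta> p (rframe p a) j)"
    by (rule onb_trace[OF tangent_frame_rframe[OF p], where G="\<lambda>x y. \<Sum>j\<in>onb p. \<beta> p x j * \<eta> p y j"])
      (intro linear_sum_fun linear_mult_right linear_mult_left bl)+
  also have "\<dots> = (\<Sum>a\<in>UNIV. \<Sum>b\<in>UNIV. frame_coeff \<beta> a b p * frame_coeff \<eta> a b p)"
    unfolding frame_coeff_def
    by (rule sum.cong[OF refl], rule onb_trace[OF tangent_frame_lframe[OF p]])
      (intro linear_mult_right linear_mult_left bl)+
  finally show "(\<Sum>a\<in>UNIV. \<Sum>b\<in>UNIV. frame_coeff \<beta> a b p * frame_coeff \<eta> a b p) = (\<Sum>i\<in>onb p. \<Sum>j\<in>onb p. \<beta> p i j * \<eta> p i j)"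
    by simp
qed

lemma L2_inner3_nabla_bar_eq:
  assumes g: "smooth_tensor2 \<gamma>" and h: "smooth_tensor2 \<eta>"
  shows "L2_inner3 (nabla_bar \<gamma>) (nabla_bar \<eta>) = integral_S3 (\<lambda>p. \<Sum>k\<in>UNIV. \<Sum>a\<in>UNIV. \<Sum>b\<in>UNIV.
    frame_deriv k (frame_coeff \<gamma> a b) p * frame_deriv k (frame_coeff \<eta> a b) p)"
  unfolding L2_inner3_def
proof (rule integral_S3_cong)
  show "continuous_on S3 (\<lambda>p. \<Sum>k\<in>UNIV. \<Sum>a\<in>UNIV. \<Sum>b\<in>UNIV.
    frame_deriv k (frame_coeff \<gamma> a b) p * frame_deriv k (frame_coeff \<eta> a b) p)"
    by (intro continuous_intros smooth_frame_deriv[THEN smooth_S3_continuous_on] smooth_frame_coeff assms)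
next
  fix p assume p: "p \<in> S3"
  define T where "T = (\<lambda>\<gamma> x y z. \<Sum>a\<in>UNIV. \<Sum>b\<in>UNIV. D_S (frame_coeff \<gamma> a b) p x * (y \<bullet> rframe p a) * (z \<bullet> lframe p b))"
  have T: "nabla_bar \<gamma> p x y z = T \<gamma> x y z" if "smooth_tensor2 \<gamma>" "x \<in> onb p" "y \<in> onb p" "z \<in> onb p" for \<gamma> x y z
    unfolding T_def using onb_props(1)[of p] that by (intro nabla_bar_eq p) auto
  have l: "linear (\<lambda>x. T \<gamma> x y z)" "linear (\<lambda>y. T \<gamma> x y z)" "linear (\<lambda>z. T \<gamma> x y z)" if "smooth_tensor2 \<gamma>" for \<gamma> x y z
    unfolding T_def
    by (intro linear_sum_fun linear_mult_right linear_mult_left linear_inner_left D_S_linear_on[OF smooth_frame_coeff[OF that] p])+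
  note L = linear_sum_fun linear_mult_right linear_mult_left l[OF g] l[OF h]
  have T_frame: "T \<gamma> (lframe p k) (rframe p a) (lframe p b) = frame_deriv k (frame_coeff \<gamma> a b) p" for \<gamma> k a b
    by (simp only: T_def frame_deriv_def frame_orthonormal[OF p] sum_of_bool2)
  have "(\<Sum>i\<in>onb p. \<Sum>j\<in>onb p. \<Sum>k\<in>onb p. nabla_bar \<gamma> p i j k * nabla_bar \<eta> p i j k)
    = (\<Sum>i\<in>onb p. \<Sum>j\<in>onb p. \<Sum>k\<in>onb p. T \<gamma> i j k * T \<eta> i j k)"
    by (intro sum.cong refl) (simp add: T g h)
  also have "\<dots> = (\<Sum>c\<in>UNIV. \<Sum>j\<in>onb p. \<Sum>k\<in>onb p. T \<gamma> (lframe p c) j k * T \<eta> (lframe p c) j k)"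
    by (rule onb_trace[OF tangent_frame_lframe[OF p], where G="\<lambda>x y. \<Sum>j\<in>onb p. \<Sum>k\<in>onb p. T \<gamma> x j k * T \<eta> y j k"])
      (intro L)+
  also have "\<dots> = (\<Sum>c\<in>UNIV. \<Sum>a\<in>UNIV. \<Sum>k\<in>onb p. T \<gamma> (lframe p c) (rframe p a) k * T \<eta> (lframe p c) (rframe p a) k)"
    by (rule sum.cong[OF refl], rule onb_trace[OF tangent_frame_rframe[OF p], where G="\<lambda>x y. \<Sum>k\<in>onb p. T \<gamma> _ x k * T \<eta> _ y k"])
      (intro L)+
  also have "\<dots> = (\<Sum>c\<in>UNIV. \<Sum>a\<in>UNIV. \<Sum>b\<in>UNIV. T \<gamma> (lframe p c) (rframe p a) (lframe p b) * T \<eta> (lframe p c) (rframe p a) (lframe p b))"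
    by (rule sum.cong[OF refl], rule sum.cong[OF refl], rule onb_trace[OF tangent_frame_lframe[OF p], where G="\<lambda>x y. T \<gamma> _ _ x * T \<eta> _ _ y"])
      (intro L)+
  finally show "(\<Sum>k\<in>UNIV. \<Sum>a\<in>UNIV. \<Sum>b\<in>UNIV. frame_deriv k (frame_coeff \<gamma> a b) p * frame_deriv k (frame_coeff \<eta> a b) p)
    = (\<Sum>i\<in>onb p. \<Sum>j\<in>onb p. \<Sum>k\<in>onb p. nabla_bar \<gamma> p i j k * nabla_bar \<eta> p i j k)"
    unfolding T_frame by simp
qed

text \<open>The difference of the two tensors, itself smooth, serves as test tensor.\<close>

lemma L2_inner2_unique:
  assumes b: "smooth_tensor2 \<beta>" "smooth_tensor2 \<beta>'"
    and eq: "\<And>\<eta>. smooth_tensor2 \<eta> \<Longrightarrow> L2_inner2 \<beta> \<eta> = L2_inner2 \<beta>' \<eta>"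
  shows "\<beta> = \<beta>'"
proof -
  define c where "c = (\<lambda>a b p. frame_coeff \<beta> a b p - frame_coeff \<beta>' a b p)"
  have sc: "smooth_S3 (c a b)" for a b unfolding c_def by (intro smooth_S3_diff smooth_frame_coeff b)
  then have s: "smooth_tensor2 (frame_tensor c)" by (rule smooth_tensor2_frame_tensor)
  note cont = sc[THEN smooth_S3_continuous_on] smooth_frame_coeff[OF b(1), THEN smooth_S3_continuous_on]
    smooth_frame_coeff[OF b(2), THEN smooth_S3_continuous_on] smooth_frame_coeff[OF s, THEN smooth_S3_continuous_on]
  let ?c = "frame_coeff (frame_tensor c)"
  have "integral_S3 (\<lambda>p. \<Sum>a\<in>UNIV. \<Sum>b\<in>UNIV. frame_coeff \<beta> a b p * ?c a b p)
    = integral_S3 (\<lambda>p. (\<Sum>a\<in>UNIV. \<Sum>b\<in>UNIV. frame_coeff \<beta>' a b p * ?c a b p) + (\<Sum>a\<in>UNIV. \<Sum>b\<in>UNIV. c a b p * c a b p))"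
    by (rule integral_S3_cong, intro continuous_intros cont)
      (simp add: frame_coeff_frame_tensor c_def algebra_simps flip: sum.distrib)
  also have "\<dots> = integral_S3 (\<lambda>p. \<Sum>a\<in>UNIV. \<Sum>b\<in>UNIV. frame_coeff \<beta>' a b p * ?c a b p) + integral_S3 (\<lambda>p. \<Sum>a\<in>UNIV. \<Sum>b\<in>UNIV. c a b p * c a b p)"
    by (rule integral_S3_add; intro continuous_intros cont)
  finally have 0: "integral_S3 (\<lambda>p. \<Sum>a\<in>UNIV. \<Sum>b\<in>UNIV. c a b p * c a b p) = 0"
    using eq[OF s] by (simp add: L2_inner2_eq b s)
  have "c a b p = 0" if p: "p \<in> S3" for a b p
  proof -
    have "(\<Sum>a\<in>UNIV. \<Sum>b\<in>UNIV. c a b p * c a b p) = 0"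
      by (rule integral_S3_eq_0_imp[OF _ _ 0 p]) (intro continuous_intros cont sum_nonneg zero_le_square)+
    then show ?thesis by (simp add: sum_nonneg_eq_0_iff sum_nonneg)
  qed
  then have "frame_tensor (frame_coeff \<beta>) = frame_tensor (frame_coeff \<beta>')"
    by (intro frame_tensor_cong) (simp add: c_def)
  then show ?thesis using smooth_tensor2_eq_frame_tensor b by metis
qed

text \<open>In the sign convention of a nonnegative operator: minus the Laplacian of the sphere on each coefficient.\<close>

definition rough_laplacian :: "tensor2 \<Rightarrow> tensor2" where
  "rough_laplacian \<gamma> = frame_tensor (\<lambda>a b p. - (\<Sum>k\<in>UNIV. frame_deriv k (frame_deriv k (frame_coeff \<gamma> a b)) p))"

lemma smooth_rough_laplacian: "smooth_tensor2 \<gamma> \<Longrightarrow> smooth_tensor2 (rough_laplacian \<gamma>)"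
  unfolding rough_laplacian_def
  by (intro smooth_tensor2_frame_tensor smooth_S3_uminus smooth_S3_sum smooth_frame_deriv smooth_frame_coeff)

text \<open>Integration by parts in each coefficient. This provides the existence, and \<open>L2_inner2_unique\<close> the
  uniqueness, that the definite description in \<open>nabla_bar_adj\<close> requires.\<close>

lemma L2_inner_rough_laplacian:
  assumes g: "smooth_tensor2 \<gamma>" and h: "smooth_tensor2 \<eta>"
  shows "L2_inner2 (rough_laplacian \<gamma>) \<eta> = L2_inner3 (nabla_bar \<gamma>) (nabla_bar \<eta>)"
proof -
  note s = smooth_frame_coeff[OF g] smooth_frame_coeff[OF h]
  note c = s[THEN smooth_S3_continuous_on] s[THEN smooth_frame_deriv, THEN smooth_S3_continuous_on]
    s[THEN smooth_frame_deriv, THEN smooth_frame_deriv, THEN smooth_S3_continuous_on]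
  have "L2_inner3 (nabla_bar \<gamma>) (nabla_bar \<eta>) = (\<Sum>k\<in>UNIV. \<Sum>a\<in>UNIV. \<Sum>b\<in>UNIV.
      integral_S3 (\<lambda>p. frame_deriv k (frame_coeff \<gamma> a b) p * frame_deriv k (frame_coeff \<eta> a b) p))"
    unfolding L2_inner3_nabla_bar_eq[OF g h]
    by (simp add: integral_S3_sum continuous_on_sum continuous_on_mult c)
  also have "\<dots> = (\<Sum>k\<in>UNIV. \<Sum>a\<in>UNIV. \<Sum>b\<in>UNIV.
      integral_S3 (\<lambda>p. - frame_deriv k (frame_deriv k (frame_coeff \<gamma> a b)) p * frame_coeff \<eta> a b p))"
    unfolding integral_by_parts[OF s] ..
  also have "\<dots> = integral_S3 (\<lambda>p. \<Sum>k\<in>UNIV. \<Sum>a\<in>UNIV. \<Sum>b\<in>UNIV. - frame_deriv k (frame_deriv k (frame_coeff \<gamma> a b)) p * frame_coeff \<eta> a b p)"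
    by (simp add: integral_S3_sum continuous_on_sum continuous_on_mult continuous_on_minus c del: mult_minus_left)
  also have "\<dots> = integral_S3 (\<lambda>p. \<Sum>a\<in>UNIV. \<Sum>b\<in>UNIV. frame_coeff (rough_laplacian \<gamma>) a b p * frame_coeff \<eta> a b p)"
  proof (rule integral_S3_cong)
    show "continuous_on S3 (\<lambda>p. \<Sum>a\<in>UNIV. \<Sum>b\<in>UNIV. frame_coeff (rough_laplacian \<gamma>) a b p * frame_coeff \<eta> a b p)"
      by (intro continuous_intros c smooth_frame_coeff[OF smooth_rough_laplacian[OF g], THEN smooth_S3_continuous_on])
    fix p assume p: "p \<in> S3"
    have "(\<Sum>k\<in>UNIV. \<Sum>a\<in>UNIV. \<Sum>b\<in>UNIV. - frame_deriv k (frame_deriv k (frame_coeff \<gamma> a b)) p * frame_coeff \<eta> a b p)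
      = (\<Sum>a\<in>UNIV. \<Sum>b\<in>UNIV. \<Sum>k\<in>UNIV. - frame_deriv k (frame_deriv k (frame_coeff \<gamma> a b)) p * frame_coeff \<eta> a b p)"
      by (subst sum.swap, rule sum.cong[OF refl], rule sum.swap)
    then show "(\<Sum>a\<in>UNIV. \<Sum>b\<in>UNIV. frame_coeff (rough_laplacian \<gamma>) a b p * frame_coeff \<eta> a b p)
      = (\<Sum>k\<in>UNIV. \<Sum>a\<in>UNIV. \<Sum>b\<in>UNIV. - frame_deriv k (frame_deriv k (frame_coeff \<gamma> a b)) p * frame_coeff \<eta> a b p)"
      using p by (simp add: rough_laplacian_def frame_coeff_frame_tensor sum_distrib_right sum_negf)
  qed
  finally show ?thesis by (simp add: L2_inner2_eq smooth_rough_laplacian g h)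
qed

lemma nabla_bar_adj_nabla_bar:
  assumes "smooth_tensor2 \<gamma>"
  shows "nabla_bar_adj (nabla_bar \<gamma>) = rough_laplacian \<gamma>"
  unfolding nabla_bar_adj_def
proof (rule the_equality)
  show "smooth_tensor2 (rough_laplacian \<gamma>) \<and>
    (\<forall>\<eta>. smooth_tensor2 \<eta> \<longrightarrow> L2_inner2 (rough_laplacian \<gamma>) \<eta> = L2_inner3 (nabla_bar \<gamma>) (nabla_bar \<eta>))"
    using smooth_rough_laplacian L2_inner_rough_laplacian assms by blast
  show "\<beta> = rough_laplacian \<gamma>" if "smooth_tensor2 \<beta> \<and>
    (\<forall>\<eta>. smooth_tensor2 \<eta> \<longrightarrow> L2_inner2 \<beta> \<eta> = L2_inner3 (nabla_bar \<gamma>) (nabla_bar \<eta>))" for \<beta>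
    using that L2_inner2_unique[of \<beta> "rough_laplacian \<gamma>"] smooth_rough_laplacian L2_inner_rough_laplacian assms
    by simp
qed

section \<open>Essential deformations are the parallel tensors\<close>

definition parallel_tensor :: "real^3^3 \<Rightarrow> tensor2" where
  "parallel_tensor C = frame_tensor (\<lambda>a b p. C $ a $ b)"

lemma smooth_parallel_tensor: "smooth_tensor2 (parallel_tensor C)"
  unfolding parallel_tensor_def by (intro smooth_tensor2_frame_tensor smooth_S3_const)

lemma D_S_constant:
  assumes "\<And>q. q \<in> S3 \<Longrightarrow> f q = c" "p \<in> S3" "v \<in> tangent p"
  shows "D_S f p v = 0"
proof -
  have "D_S f p = D_S (\<lambda>q. c) p" using assms by (intro D_S_cong)
  then show ?thesis using D_S_eq[OF has_derivative_const assms(2,3)] by metis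
qed

lemma essential_parallel_tensor: "essential_deformation (parallel_tensor C)"
proof -
  let ?\<gamma> = "parallel_tensor C"
  have c: "frame_coeff ?\<gamma> a b q = C $ a $ b" if "q \<in> S3" for a b q
    using that by (simp add: parallel_tensor_def frame_coeff_frame_tensor)
  have d: "D_S (frame_coeff ?\<gamma> a b) p v = 0" if "p \<in> S3" "v \<in> tangent p" for a b p v
    by (rule D_S_constant[OF c that])
  have 0: "nabla_bar ?\<gamma> p v y z = 0"
    if "p \<in> S3" "v \<in> tangent p" "y \<in> tangent p" "z \<in> tangent p" for p v y z
    unfolding nabla_bar_eq[OF smooth_parallel_tensor that] by (simp add: d[OF that(1,2)])
  have "frame_deriv k (frame_coeff ?\<gamma> a b) q = 0" if "q \<in> S3" for k a b q
    unfolding frame_deriv_def by (rule d[OF that lframe_tangent])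
  then have "frame_deriv k (frame_deriv k (frame_coeff ?\<gamma> a b)) q = 0" if "q \<in> S3" for k a b q
    unfolding frame_deriv_def[of k "frame_deriv k (frame_coeff ?\<gamma> a b)"] by (intro D_S_constant[OF _ that lframe_tangent])
  then have "rough_laplacian ?\<gamma> p y z = 0" for p y z
    by (simp add: rough_laplacian_def frame_tensor_def)
  then have "B_op ?\<gamma> p y z = 0" if "p \<in> S3" "y \<in> tangent p" for p y z
    using that by (simp add: B_op_def laplacian_bar_def nabla_bar_adj_nabla_bar smooth_parallel_tensor ring_Rm_plus_zero)
  then show ?thesis
    using 0 subsetD[OF onb_props(1)] unfolding essential_deformation_def
    by (auto simp: smooth_parallel_tensor intro!: sum.neutral)
qed

text \<open>Pairing the equation with the tensor itself shows that the squares of all derivatives of its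
  coefficients have integral \<open>0\<close>, so the coefficients are constant.\<close>

lemma essential_imp_parallel_tensor:
  assumes "essential_deformation \<gamma>"
  shows "\<exists>C. \<gamma> = parallel_tensor C"
proof -
  have g: "smooth_tensor2 \<gamma>" and B: "\<And>p y z. p \<in> S3 \<Longrightarrow> y \<in> tangent p \<Longrightarrow> z \<in> tangent p \<Longrightarrow> B_op \<gamma> p y z = 0"
    using assms unfolding essential_deformation_def by blast+
  have "frame_coeff (rough_laplacian \<gamma>) a b p = 0" if p: "p \<in> S3" for a b p
    using B[OF p rframe_tangent lframe_tangent]
    by (simp add: B_op_def laplacian_bar_def nabla_bar_adj_nabla_bar g ring_Rm_plus_zero[OF p rframe_tangent] frame_coeff_def)
  then have "L2_inner2 (rough_laplacian \<gamma>) \<gamma> = integral_S3 (\<lambda>p. 0)"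
    unfolding L2_inner2_eq[OF smooth_rough_laplacian[OF g] g] by (intro integral_S3_cong) auto
  then have 0: "integral_S3 (\<lambda>p. \<Sum>k\<in>UNIV. \<Sum>a\<in>UNIV. \<Sum>b\<in>UNIV.
      frame_deriv k (frame_coeff \<gamma> a b) p * frame_deriv k (frame_coeff \<gamma> a b) p) = 0"
    using L2_inner_rough_laplacian[OF g g] L2_inner3_nabla_bar_eq[OF g g] by (simp add: integral_S3_def)
  have fd: "frame_deriv k (frame_coeff \<gamma> a b) p = 0" if p: "p \<in> S3" for k a b p
  proof -
    have "(\<Sum>k\<in>UNIV. \<Sum>a\<in>UNIV. \<Sum>b\<in>UNIV. frame_deriv k (frame_coeff \<gamma> a b) p * frame_deriv k (frame_coeff \<gamma> a b) p) = 0"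
      by (rule integral_S3_eq_0_imp[OF _ _ 0 p])
        (intro continuous_intros smooth_frame_deriv[THEN smooth_S3_continuous_on] smooth_frame_coeff g sum_nonneg zero_le_square)+
    then show ?thesis by (simp add: sum_nonneg_eq_0_iff sum_nonneg)
  qed
  \<comment> \<open>any point of the sphere can serve as base point\<close>
  have const: "frame_coeff \<gamma> a b p = frame_coeff \<gamma> a b (axis 1 1)" if p: "p \<in> S3" for a b p
  proof (rule D_S_zero_imp_constant[OF smooth_frame_coeff[OF g] _ _ p])
    show "D_S (frame_coeff \<gamma> a b) q v = 0" if q: "q \<in> S3" and v: "v \<in> tangent q" for q v
      using linear_tangent_frame[OF tangent_frame_lframe[OF q] v D_S_linear_on[OF smooth_frame_coeff[OF g] q]] fd[OF q]
      by (simp add: frame_deriv_def)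
  qed (simp add: norm_axis_1)
  have "frame_tensor (frame_coeff \<gamma>) = parallel_tensor (\<chi> a b. frame_coeff \<gamma> a b (axis 1 1))"
    unfolding parallel_tensor_def vec_lambda_beta by (rule frame_tensor_cong) (rule const)
  then show ?thesis using smooth_tensor2_eq_frame_tensor[OF g] by metis
qed

section \<open>Tensors built from quadratic forms\<close>

lemma D_S_quadratic:
  assumes S: "linear S" "\<And>x y. S x \<bullet> y = x \<bullet> S y"
    and u: "\<And>q. q \<in> S3 \<Longrightarrow> u q = q \<bullet> S q" and p: "p \<in> S3" and v: "v \<in> tangent p"
  shows "D_S u p v = 2 * (v \<bullet> S p)"
proof -
  have "D_S u p v = D_S (\<lambda>q. q \<bullet> S q) p v" by (rule fun_cong[OF D_S_cong[OF u p]])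
  also have "\<dots> = p \<bullet> D_S S p v + D_S (\<lambda>q. q) p v \<bullet> S p"
    by (rule D_S_inner[OF _ _ p v]) (intro smooth_S3_linear S linear_ident)+
  also have "\<dots> = 2 * (v \<bullet> S p)"
    using S(2)[of p v] by (simp add: D_S_linear[OF _ p v] S(1) linear_ident inner_commute)
  finally show ?thesis .
qed

text \<open>The term with \<open>u p\<close> is the normal derivative of the quadratic form, which enters through the second
  fundamental form of the sphere.\<close>

lemma hessian_quadratic:
  assumes S: "linear S" "\<And>x y. S x \<bullet> y = x \<bullet> S y"
    and u: "\<And>q. q \<in> S3 \<Longrightarrow> u q = q \<bullet> S q"
    and p: "p \<in> S3" and y: "y \<in> tangent p" and z: "z \<in> tangent p"
  shows "hessian u p y z = 2 * (y \<bullet> S z) - 2 * u p * (y \<bullet> z)"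
proof -
  note D = D_S_quadratic[OF S u]
  have e: "ext y p = y" "ext z p = z" using y z by (simp_all add: ext_def tproj_id)
  have "D_S u p (nabla (ext y) (ext z) p) = 0"
    using D[OF _ p, of 0] by (simp add: nabla_ext[OF p z y] subspace_0[OF subspace_tangent])
  moreover have "D_S (\<lambda>q. D_S u q (ext z q)) p y = 2 * (y \<bullet> S z) - 2 * u p * (y \<bullet> z)"
  proof -
    have 1: "D_S (\<lambda>q. D_S u q (ext z q)) p = D_S (\<lambda>q. 2 * (z \<bullet> S q) - 2 * ((z \<bullet> q) * (q \<bullet> S q))) p"
    proof (rule D_S_cong[OF _ p])
      fix q assume q: "q \<in> S3"
      have "D_S u q (ext z q) = 2 * (tproj q z \<bullet> S q)"
        unfolding ext_def by (rule D[OF _ q tproj_tangent[OF q]])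
      then show "D_S u q (ext z q) = 2 * (z \<bullet> S q) - 2 * ((z \<bullet> q) * (q \<bullet> S q))"
        by (simp add: tproj_def inner_diff_left algebra_simps)
    qed
    have 2: "((\<lambda>q. 2 * (z \<bullet> S q) - 2 * ((z \<bullet> q) * (q \<bullet> S q))) has_derivative
       (\<lambda>h. 2 * (z \<bullet> S h) - 2 * ((z \<bullet> p) * (p \<bullet> S h + h \<bullet> S p) + (z \<bullet> h) * (p \<bullet> S p)))) (at p within S3)"
    proof -
      have dS: "(S has_derivative S) (at p within S3)"
        using S(1) by (simp add: bounded_linear_imp_has_derivative linear_conv_bounded_linear)
      show ?thesis
        by (intro has_derivative_diff has_derivative_mult_right has_derivative_mult has_derivative_inner_right
            has_derivative_inner has_derivative_ident dS)
    qed
    have "D_S (\<lambda>q. D_S u q (ext z q)) p y =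
       2 * (z \<bullet> S y) - 2 * ((z \<bullet> p) * (p \<bullet> S y + y \<bullet> S p) + (z \<bullet> y) * (p \<bullet> S p))"
      unfolding 1 by (rule D_S_eq[OF 2 p y])
    then show ?thesis using S(2)[of z y] z by (simp add: u[OF p] tangent_def inner_commute)
  qed
  ultimately show ?thesis by (simp add: hessian_def Let_def e)
qed

lemma dV_linear_first: "linear (\<lambda>p. dV p x y z)"
  unfolding dV_def det_4 by (auto intro!: linearI simp: algebra_simps)

lemma dV_tproj: "dV q (tproj q x) (tproj q y) (tproj q z) = dV q x y z"
  by (simp add: tproj_def linear_diff[OF dV_linear(1)] linear_diff[OF dV_linear(2)] linear_diff[OF dV_linear(3)]
      linear_scale[OF dV_linear(1)] linear_scale[OF dV_linear(2)] linear_scale[OF dV_linear(3)] dV_alt)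

text \<open>The volume form is parallel, so the derivative falls on \<open>u\<close>; the normal component of the gradient
  \<open>2 *\<^sub>R S p\<close> does not contribute to \<open>dV p\<close>.\<close>

lemma codiff3_quadratic:
  assumes S: "linear S" "\<And>x y. S x \<bullet> y = x \<bullet> S y"
    and u: "\<And>q. q \<in> S3 \<Longrightarrow> u q = q \<bullet> S q"
    and p: "p \<in> S3" and y: "y \<in> tangent p" and z: "z \<in> tangent p"
  shows "codiff3 (\<lambda>q a b c. u q * H q a b c) p y z = - 4 * dV p (S p) y z"
proof -
  have us: "smooth_S3 u"
    by (rule smooth_S3_cong[of "\<lambda>q. q \<bullet> S q"]) (intro smooth_S3_inner smooth_S3_linear S linear_ident, simp add: u)
  have n: "nabla3 (\<lambda>q a b c. u q * H q a b c) p l l y z = 4 * ((l \<bullet> S p) * dV p l y z)" if "l \<in> onb p" for l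
  proof -
    have l: "l \<in> tangent p" using that onb_props(1) by blast
    have e: "ext l p = l" using l by (simp add: ext_def tproj_id)
    have ld: "linear (\<lambda>q. 2 * dV q l y z)" by (rule linear_mult_left[OF dV_linear_first])
    have "D_S (\<lambda>q. u q * H q (ext l q) (ext y q) (ext z q)) p l = D_S (\<lambda>q. u q * (2 * dV q l y z)) p l"
      by (simp add: H_def ext_def dV_tproj)
    also have "\<dots> = 4 * ((l \<bullet> S p) * dV p l y z)"
      using D_S_mult[OF us smooth_S3_linear[OF ld] p l] D_S_linear[OF ld p l] D_S_quadratic[OF S u p l]
      by (simp add: dV_alt)
    finally show ?thesis
      by (simp add: nabla3_def e nabla_ext[OF p] l y z H_def
          linear_0[OF dV_linear(1)] linear_0[OF dV_linear(2)] linear_0[OF dV_linear(3)])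
  qed
  have "(\<Sum>l\<in>onb p. (l \<bullet> S p) * dV p l y z) = (\<Sum>k\<in>UNIV. (lframe p k \<bullet> S p) * dV p (lframe p k) y z)"
    by (rule onb_trace[OF tangent_frame_lframe[OF p], where G="\<lambda>x x'. (x \<bullet> S p) * dV p x' y z"])
      (intro linear_mult_left linear_mult_right dV_linear linear_inner_left)+
  also have "\<dots> = dV p ((S p \<bullet> p) *\<^sub>R p + (\<Sum>k\<in>UNIV. (S p \<bullet> lframe p k) *\<^sub>R lframe p k)) y z"
    by (simp add: linear_add[OF dV_linear(1)] linear_sum[OF dV_linear(1)] linear_scale[OF dV_linear(1)] dV_alt inner_commute)
  also have "\<dots> = dV p (S p) y z" using vec_expand_lframe[OF p, of "S p"] by simp
  finally show ?thesis by (simp add: codiff3_def n flip: sum_distrib_left)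
qed

text \<open>The pointwise identity behind the formula for the deformations. Writing \<open>z = lmul \<zeta> p\<close> turns the
  volume form into an inner product by \<open>dV_lmul\<close>, after which the Clifford relation for \<open>b\<close> and \<open>\<zeta>\<close>
  leaves \<open>- 2 * (b \<bullet> \<zeta>)\<close>.\<close>

lemma frame_product_identity:
  assumes p: "p \<in> S3" and y: "y \<in> tangent p" and z: "z \<in> tangent p"
  shows "(p \<bullet> rmul a (lmul b p)) * (y \<bullet> z) + y \<bullet> rmul a (lmul b z) + dV p (rmul a (lmul b p)) y z
    = - 2 * (y \<bullet> rmul a p) * (z \<bullet> lmul b p)"
proof -
  define \<zeta> where "\<zeta> = (\<Sum>i\<in>UNIV. (z \<bullet> lframe p i) *\<^sub>R (axis i 1 :: real^3))"
  have "lmul \<zeta> p = (\<Sum>i\<in>UNIV. (z \<bullet> lframe p i) *\<^sub>R lframe p i)"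
    by (simp add: \<zeta>_def lframe_def linear_sum[OF linear_lmul_left] linear_scale[OF linear_lmul_left])
  also have "\<dots> = z"
    using tangent_frame_lframe[OF p] z unfolding tangent_frame_def by metis
  finally have z\<zeta>: "z = lmul \<zeta> p" by simp
  let ?w = "rmul a (lmul b p)"
  have "dV p ?w y z = y \<bullet> lmul \<zeta> ?w - (?w \<bullet> p) * (y \<bullet> z)"
    using y by (simp add: z\<zeta> dV_lmul S3_inner[OF p] tangent_def)
  moreover have "y \<bullet> rmul a (lmul b z) + y \<bullet> lmul \<zeta> ?w = y \<bullet> rmul a (lmul b (lmul \<zeta> p) + lmul \<zeta> (lmul b p))"
    by (simp add: z\<zeta> lmul_rmul_commute linear_add[OF linear_rmul] inner_add_right)
  moreover have "\<dots> = - 2 * (b \<bullet> \<zeta>) * (y \<bullet> rmul a p)"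
    by (simp add: lmul_clifford linear_scale[OF linear_rmul] linear_neg[OF linear_rmul])
  moreover have "z \<bullet> lmul b p = b \<bullet> \<zeta>"
    by (simp add: z\<zeta> inner_lmul_lmul S3_inner[OF p] inner_commute)
  ultimately show ?thesis by (simp add: inner_commute)
qed

text \<open>The function \<open>u\<close> is found by taking traces: the trace of \<open>4 u g\<close> is \<open>12 u\<close>, that of the Hessian is
  \<open>- 8 u\<close> for a harmonic quadratic form, and \<open>d\<^sup>*(u H)\<close> is skew. So \<open>4 u\<close> has to be the trace of the
  tensor, which at \<open>p\<close> is the sum of the \<open>C $ a $ b * (rframe p a \<bullet> lframe p b)\<close>; moving
  \<open>rmul\<close> to the other side of the inner product gives the minus sign.\<close>

definition potential_matrix :: "real^3^3 \<Rightarrow> real^4 \<Rightarrow> real^4" where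
  "potential_matrix C p = (\<Sum>a\<in>UNIV. \<Sum>b\<in>UNIV. (- C $ a $ b / 4) *\<^sub>R rmul (axis a 1) (lmul (axis b 1) p))"

lemma linear_potential_matrix: "linear (potential_matrix C)"
  unfolding potential_matrix_def[abs_def]
  by (intro linear_sum_fun linear_compose_scale_right linear_compose[OF linear_lmul linear_rmul, unfolded o_def])

lemma potential_matrix_selfadjoint: "potential_matrix C x \<bullet> y = x \<bullet> potential_matrix C y"
  by (simp add: potential_matrix_def inner_sum_left inner_sum_right rmul_skew lmul_skew lmul_rmul_commute)

lemma parallel_tensor_eq:
  assumes p: "p \<in> S3" and y: "y \<in> tangent p" and z: "z \<in> tangent p"
    and u: "\<And>q. q \<in> S3 \<Longrightarrow> u q = q \<bullet> potential_matrix C q"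
  shows "parallel_tensor C p y z = 4 * u p * (y \<bullet> z) + hessian u p y z
           - 1/2 * codiff3 (\<lambda>q a b c. u q * H q a b c) p y z"
proof -
  let ?S = "potential_matrix C"
  define k where "k = (\<lambda>a b. - C $ a $ b / 4)"
  have S: "?S q = (\<Sum>a\<in>UNIV. \<Sum>b\<in>UNIV. k a b *\<^sub>R rmul (axis a 1) (lmul (axis b 1) q))" for q
    by (simp add: potential_matrix_def k_def)
  let ?T = "\<lambda>a b. rmul (axis a 1) (lmul (axis b 1) p)"
  have "4 * u p * (y \<bullet> z) + hessian u p y z - 1/2 * codiff3 (\<lambda>q a b c. u q * H q a b c) p y z
      = 2 * ((p \<bullet> ?S p) * (y \<bullet> z) + y \<bullet> ?S z + dV p (?S p) y z)"
    using hessian_quadratic[OF linear_potential_matrix potential_matrix_selfadjoint u p y z]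
      codiff3_quadratic[OF linear_potential_matrix potential_matrix_selfadjoint u p y z] u[OF p]
    by (simp add: algebra_simps)
  also have "\<dots> = 2 * (\<Sum>a\<in>UNIV. \<Sum>b\<in>UNIV. k a b *
      ((p \<bullet> ?T a b) * (y \<bullet> z) + y \<bullet> rmul (axis a 1) (lmul (axis b 1) z) + dV p (?T a b) y z))"
    unfolding S
    by (simp add: inner_sum_right linear_sum[OF dV_linear(1)] linear_scale[OF dV_linear(1)]
        distrib_left sum.distrib sum_distrib_right mult.assoc)
  also have "\<dots> = (\<Sum>a\<in>UNIV. \<Sum>b\<in>UNIV. C $ a $ b * (y \<bullet> rframe p a) * (z \<bullet> lframe p b))"
    unfolding frame_product_identity[OF p y z] sum_distrib_left
    by (intro sum.cong refl) (simp add: k_def rframe_def lframe_def)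
  finally show ?thesis using p by (simp add: parallel_tensor_def frame_tensor_def)
qed

section \<open>Harmonic polynomials and dimension count\<close>

text \<open>The matrix is a combination of the nine products of a left and a right multiplication, which are
  symmetric and traceless.\<close>

lemma potential_in_span:
  "restrict_S3 (\<lambda>p. p \<bullet> potential_matrix C p) \<in> span (restrict_S3 `
     {\<lambda>x. x$1 * x$2, \<lambda>x. x$1 * x$3, \<lambda>x. x$1 * x$4, \<lambda>x. x$2 * x$3, \<lambda>x. x$2 * x$4, \<lambda>x. x$3 * x$4,
      \<lambda>x. (x$1)^2 - (x$2)^2, \<lambda>x. (x$1)^2 - (x$3)^2, \<lambda>x. (x$1)^2 - (x$4)^2})"
  (is "_ \<in> span (_ ` ?B)")
proof -
  define b where "b = (\<lambda>f. restrict_S3 f \<in> span (restrict_S3 ` ?B))"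
  have base: "b f" if "f \<in> ?B" for f unfolding b_def by (rule span_base) (use that in blast)
  have add: "b (\<lambda>x. f x + g x)" if "b f" "b g" for f g
  proof -
    have "restrict_S3 (\<lambda>x. f x + g x) = restrict_S3 f + restrict_S3 g" by (auto simp: restrict_S3_def)
    then show ?thesis using that span_add by (simp add: b_def)
  qed
  have scale: "b (\<lambda>x. c * f x)" if "b f" for f c
  proof -
    have "restrict_S3 (\<lambda>x. c * f x) = c *\<^sub>R restrict_S3 f" by (auto simp: restrict_S3_def scaleR_fun_def)
    then show ?thesis using that span_scale by (simp add: b_def)
  qed
  \<comment> \<open>the inner product of \<open>p i\<close> and \<open>i p\<close> is \<open>(x$1)^2 + (x$2)^2 - (x$3)^2 - (x$4)^2\<close>, and cyclically;
    distinct imaginary units give sums and differences of mixed monomials\<close>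
  have eq: "(\<lambda>p. p \<bullet> potential_matrix C p) = (\<lambda>x.
      (- C$1$1/4) * ((x$1)^2 - (x$2)^2) + ((C$1$1/4) * ((x$1)^2 - (x$3)^2) + ((C$1$1/4) * ((x$1)^2 - (x$4)^2) +
      ((C$2$2/4) * ((x$1)^2 - (x$2)^2) + ((- C$2$2/4) * ((x$1)^2 - (x$3)^2) + ((C$2$2/4) * ((x$1)^2 - (x$4)^2) +
      ((C$3$3/4) * ((x$1)^2 - (x$2)^2) + ((C$3$3/4) * ((x$1)^2 - (x$3)^2) + ((- C$3$3/4) * ((x$1)^2 - (x$4)^2) +
      (((C$1$2 + C$2$1)/2) * (x$2 * x$3) + (((C$1$2 - C$2$1)/2) * (x$1 * x$4) +
      (((C$1$3 + C$3$1)/2) * (x$2 * x$4) + (((C$3$1 - C$1$3)/2) * (x$1 * x$3) +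
      (((C$2$3 + C$3$2)/2) * (x$3 * x$4) + ((C$2$3 - C$3$2)/2) * (x$1 * x$2)))))))))))))))"
    by (simp add: fun_eq_iff potential_matrix_def sum_3 lmul_def rmul_def axis_def inner4 field_simps power2_eq_square)
  have "b (\<lambda>p. p \<bullet> potential_matrix C p)"
    unfolding eq by (intro add scale base) simp_all
  then show ?thesis by (simp only: b_def)
qed

lemma linear_parallel_tensor: "linear parallel_tensor"
  by (rule linearI) (auto simp: parallel_tensor_def frame_tensor_def fun_eq_iff scaleR_fun_def
      sum.distrib sum_distrib_left algebra_simps)

lemma inj_parallel_tensor: "inj parallel_tensor"
proof (rule injI)
  fix C D assume "parallel_tensor C = parallel_tensor D"
  moreover have "C $ a $ b = frame_coeff (parallel_tensor C) a b (axis 1 1)" for C :: "real^3^3" and a b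
    unfolding parallel_tensor_def by (rule frame_coeff_frame_tensor[symmetric]) (simp add: norm_axis_1)
  ultimately show "C = D" by (simp add: vec_eq_iff)
qed

lemma essential_deformations_eq: "{\<gamma>. essential_deformation \<gamma>} = range parallel_tensor"
  using essential_parallel_tensor by (auto dest: essential_imp_parallel_tensor)

lemma dim_range_linear_inj:
  fixes f :: "'a::euclidean_space \<Rightarrow> 'b::real_vector"
  assumes "linear f" "inj f"
  shows "dim (range f) = DIM('a)"
proof -
  have "independent (f ` Basis)"
    by (rule linear_independent_injective_image[OF assms(1) independent_Basis]) (simp add: assms(2))
  moreover have "span (f ` Basis) = range f"
    using linear_span_image[OF assms(1), of Basis] by simp
  ultimately have "dim (range f) = card (f ` Basis)"
    using dim_span_eq_card_independent by metis
  then show ?thesis using assms(2) by (simp add: card_image inj_on_subset)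
qed

theorem corollary5p12:
  shows "(\<forall>\<gamma>. essential_deformation \<gamma> \<longrightarrow>
            (\<exists>u \<in> span (restrict_S3 ` {\<lambda>x. x$1 * x$2, \<lambda>x. x$1 * x$3, \<lambda>x. x$1 * x$4,
                                     \<lambda>x. x$2 * x$3, \<lambda>x. x$2 * x$4, \<lambda>x. x$3 * x$4,
                                     \<lambda>x. (x$1)^2 - (x$2)^2, \<lambda>x. (x$1)^2 - (x$3)^2,
                                     \<lambda>x. (x$1)^2 - (x$4)^2}).
               \<forall>p\<in>S3. \<forall>y\<in>tangent p. \<forall>z\<in>tangent p.
                 \<gamma> p y z = 4 * u p * (y \<bullet> z) + hessian u p y z
                   - 1/2 * codiff3 (\<lambda>q a b c. u q * H q a b c) p y z))
       \<and> subspace {\<gamma>. essential_deformation \<gamma>}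
       \<and> dim {\<gamma>. essential_deformation \<gamma>} = 9"
proof (intro conjI allI impI)
  fix \<gamma> assume "essential_deformation \<gamma>"
  then obtain C where C: "\<gamma> = parallel_tensor C" using essential_imp_parallel_tensor by blast
  define u where "u = restrict_S3 (\<lambda>p. p \<bullet> potential_matrix C p)"
  have u: "u q = q \<bullet> potential_matrix C q" if "q \<in> S3" for q
    using that by (simp add: u_def restrict_S3_def)
  show "\<exists>u \<in> span (restrict_S3 ` {\<lambda>x. x$1 * x$2, \<lambda>x. x$1 * x$3, \<lambda>x. x$1 * x$4,
                                     \<lambda>x. x$2 * x$3, \<lambda>x. x$2 * x$4, \<lambda>x. x$3 * x$4,
                                     \<lambda>x. (x$1)^2 - (x$2)^2, \<lambda>x. (x$1)^2 - (x$3)^2,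
                                     \<lambda>x. (x$1)^2 - (x$4)^2}).
               \<forall>p\<in>S3. \<forall>y\<in>tangent p. \<forall>z\<in>tangent p.
                 \<gamma> p y z = 4 * u p * (y \<bullet> z) + hessian u p y z
                   - 1/2 * codiff3 (\<lambda>q a b c. u q * H q a b c) p y z"
    unfolding C
    by (rule bexI[of _ u], intro ballI, rule parallel_tensor_eq[OF _ _ _ u], assumption+)
      (simp only: u_def potential_in_span)
next
  show "subspace {\<gamma>. essential_deformation \<gamma>}"
    unfolding essential_deformations_eq by (rule linear_subspace_image[OF linear_parallel_tensor subspace_UNIV])
  show "dim {\<gamma>. essential_deformation \<gamma>} = 9"
    unfolding essential_deformations_eq dim_range_linear_inj[OF linear_parallel_tensor inj_parallel_tensor]
    by simp
qed

end
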